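(* Let $(Z_n)_{n\ge 0}$ be the exploration Markov chain on $\{0,\dots,N\}$ described in the context, with scaled process $Z^N_t = Z_{[tN]}/N$. If there exists a function $\gamma$ on $\mathbb{R}^+$, Lipschitz continuous with constant $C_L$, such that $$\sup_{x}\Bigl|\gamma_N(x)-\gamma\Bigl(\frac{x}{N}\Bigr)\Bigr|\le \delta_N ,$$ then for $p>1$ and $T>0$, $$\Bigl\| \sup_{s\in[0,T]}|Z^N_s-z(s)|\Bigr\|_p\le\Bigl(\delta_N T+\frac{1+\bar\gamma_N}{N}+\kappa_p\Bigl\|\frac{M_{[TN]}}{N}\Bigr\|_p\Bigr)e^{C_LT},$$ where $\kappa_p=p/(p-1)$, and $z(t)$ denotes the solution of the deterministic differential equation $$\dot z(t)=1+\gamma(z(t)),\qquad z(0)=0,\qquad\text{for } t\le T^*=\min\{s: z(s)=1\}.$$ Here $M_n=Z_n-\sum_{i=0}^{n-1}\bigl(1+\gamma_N(Z_i)\bigr)$ denotes a global martingale. For $p=2$ the bound reduces to $$\Bigl\| \sup_{t\in[0,T]}|Z^N_t-z(t)|\Bigr\|_2\le\Bigl(\delta_NT+\frac{1+\bar\gamma_N}{N}+2\sqrt{\frac{\bar\psi_NT}{N}}\Bigr)e^{C_LT}=:\omega_N.$$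
   Context: Exploration process: in a (random) graph on $N$ vertices, no vertex is initially explored; at each step one unexplored vertex is selected, and it and all its unexplored neighbours become explored. $Z_n$ is the number of explored vertices after $n$ steps. Standing homogeneity assumption: for a partition $(\mathcal G_1,\mathcal G_2)$ of the graph, the mean number of edges from $\mathcal G_1$ to $\mathcal G_2$ depends only on the sizes of the two parts; under it, the law of the number of unexplored neighbours of the vertex selected at step $n$ depends only on $Z_{n-1}$. So $(Z_n)$ is a strictly increasing Markov chain (until absorption at $N$) with $Z_0=0$ and $$\mathbb{P}[Z_n=x+k+1\mid Z_{n-1}=x]=p_N(k,x),\quad k\ge 0,$$ where $p_N(\cdot,x)$ is the distribution of the number of neighbours, in the unexplored part, of an unexplored vertex when $x$ vertices have been explored. Write $$\gamma_N(x)=\sum_{k=0}^{N-1}k\,p_N(k,x),\quad \psi_N(x)=\sum_{k=0}^{N-1}(k-\gamma_N(x))^2p_N(k,x),\quad \bar\gamma_N=\sup_x\gamma_N(x),\quad \bar\psi_N=\sup_x\psi_N(x).$$ $\|X\|_p=\mathbb{E}[|X|^p]^{1/p}$, and $[x]$ is the integer part of $x$.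
   Formalization: In M_n the sum runs only over steps i with Z_i < N, since γ_N(N) is undefined and with the literal sum M_n is not a martingale after absorption (e.g. N=1); suprema over x range over x < N, and z is held at 1 after T*. *)

theory Defs
  imports "HOL-Probability.Probability"
begin

section \<open>The exploration Markov chain\<close>

text \<open>
  \<open>p x\<close> is the law \<open>p\<^sub>N(\<cdot>, x)\<close> of the number of unexplored neighbours of an unexplored vertex
  when \<open>x\<close> vertices are explored. It is meaningful only for \<open>x < N\<close> (at \<open>x = N\<close> there is no
  unexplored vertex), and the selected vertex then has at most \<open>N - x - 1\<close> unexplored neighbours.
  The values \<open>p x\<close> with \<open>x \<ge> N\<close> are never used. The graph enters only through \<open>p\<close>: the
  homogeneity assumption on it is what makes \<open>Z\<close> a Markov chain.
\<close>

locale exploration_chain = prob_space P for P :: "'a measure" +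
  fixes N :: nat and p :: "nat \<Rightarrow> nat pmf" and Z :: "nat \<Rightarrow> 'a \<Rightarrow> nat"
  assumes N_pos: "0 < N"
    and p_support: "\<And>x. x < N \<Longrightarrow> set_pmf (p x) \<subseteq> {..<N - x}"
    and Z_measurable: "\<And>n. Z n \<in> measurable P (count_space UNIV)"
    and Z_start: "AE \<omega> in P. Z 0 \<omega> = 0"
    and Z_Markov: "\<And>n xs y. \<P>(\<omega> in P. \<forall>i\<le>n. Z i \<omega> = xs i) > 0 \<Longrightarrow>
          \<P>(\<omega> in P. Z (Suc n) \<omega> = y \<bar> \<forall>i\<le>n. Z i \<omega> = xs i)
            = \<P>(\<omega> in P. Z (Suc n) \<omega> = y \<bar> Z n \<omega> = xs n)"
    and Z_transition: "\<And>n x k. x < N \<Longrightarrow> \<P>(\<omega> in P. Z n \<omega> = x) > 0 \<Longrightarrow>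
          \<P>(\<omega> in P. Z (Suc n) \<omega> = x + k + 1 \<bar> Z n \<omega> = x) = pmf (p x) k"
    and Z_absorbed: "\<And>n. \<P>(\<omega> in P. Z n \<omega> = N) > 0 \<Longrightarrow>
          \<P>(\<omega> in P. Z (Suc n) \<omega> = N \<bar> Z n \<omega> = N) = 1"

definition gammaN :: "nat \<Rightarrow> (nat \<Rightarrow> nat pmf) \<Rightarrow> nat \<Rightarrow> real" where
  "gammaN N p x = (\<Sum>k = 0..N - 1. real k * pmf (p x) k)"

definition psiN :: "nat \<Rightarrow> (nat \<Rightarrow> nat pmf) \<Rightarrow> nat \<Rightarrow> real" where
  "psiN N p x = (\<Sum>k = 0..N - 1. (real k - gammaN N p x)\<^sup>2 * pmf (p x) k)"

text \<open>Suprema over \<open>x\<close> range over the non-absorbed states \<open>0, \<dots>, N - 1\<close>.\<close>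

definition gammaN_bar :: "nat \<Rightarrow> (nat \<Rightarrow> nat pmf) \<Rightarrow> real" where
  "gammaN_bar N p = (SUP x\<in>{..<N}. gammaN N p x)"

definition psiN_bar :: "nat \<Rightarrow> (nat \<Rightarrow> nat pmf) \<Rightarrow> real" where
  "psiN_bar N p = (SUP x\<in>{..<N}. psiN N p x)"

definition scaled_process :: "nat \<Rightarrow> (nat \<Rightarrow> 'a \<Rightarrow> nat) \<Rightarrow> real \<Rightarrow> 'a \<Rightarrow> real" where
  "scaled_process N Z t \<omega> = real (Z (nat \<lfloor>t * real N\<rfloor>) \<omega>) / real N"

text \<open>
  The mean increment of \<open>Z\<close> in state \<open>x < N\<close> is \<open>1 + gammaN N p x\<close>, and it is \<open>0\<close> in the absorbing
  state. So the compensator collects only the steps taken from a state \<open>Z i \<omega> < N\<close>; summing the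
  terms of the absorbed steps as well would not give a martingale beyond absorption.
\<close>

definition comp_process ::
    "nat \<Rightarrow> (nat \<Rightarrow> nat pmf) \<Rightarrow> (nat \<Rightarrow> 'a \<Rightarrow> nat) \<Rightarrow> nat \<Rightarrow> 'a \<Rightarrow> real" where
  "comp_process N p Z n \<omega> =
     real (Z n \<omega>) - (\<Sum>i | i < n \<and> Z i \<omega> < N. 1 + gammaN N p (Z i \<omega>))"

section \<open>Martingales and norms\<close>

definition natural_filtration ::
    "'a measure \<Rightarrow> (nat \<Rightarrow> 'a \<Rightarrow> nat) \<Rightarrow> nat \<Rightarrow> 'a measure" where
  "natural_filtration P Z n = sigma (space P) {Z i -` A \<inter> space P | i A. i \<le> n}"

definition is_martingale ::
    "'a measure \<Rightarrow> (nat \<Rightarrow> 'a measure) \<Rightarrow> (nat \<Rightarrow> 'a \<Rightarrow> real) \<Rightarrow> bool" where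
  "is_martingale P F X \<longleftrightarrow>
     filtration (space P) F \<and> (\<forall>n. subalgebra P (F n)) \<and>
     (\<forall>n. X n \<in> borel_measurable (F n)) \<and> (\<forall>n. integrable P (X n)) \<and>
     (\<forall>n. AE \<omega> in P. real_cond_exp P (F n) (X (Suc n)) \<omega> = X n \<omega>)"

definition Lp_norm :: "'a measure \<Rightarrow> real \<Rightarrow> ('a \<Rightarrow> real) \<Rightarrow> real" where
  "Lp_norm P p X = (\<integral>\<omega>. \<bar>X \<omega>\<bar> powr p \<partial>P) powr (1 / p)"

section \<open>The deterministic limit\<close>

text \<open>\<open>Tstar = min {s. z s = 1}\<close> over \<open>s \<ge> 0\<close>, with \<open>Tstar = \<infinity>\<close> if \<open>z\<close> never reaches \<open>1\<close>.\<close>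

definition first_time_at_one :: "(real \<Rightarrow> real) \<Rightarrow> ereal \<Rightarrow> bool" where
  "first_time_at_one z Tstar \<longleftrightarrow>
     (\<forall>s\<ge>0. ereal s < Tstar \<longrightarrow> z s \<noteq> 1) \<and>
     (Tstar = \<infinity> \<or> (\<exists>s\<ge>0. Tstar = ereal s \<and> z s = 1))"

text \<open>
  The function \<open>\<gamma>\<close> is given on the nonnegative reals only, so a solution has to stay there. At the
  ends of the time interval the derivative is one-sided. After \<open>Tstar\<close>, where the differential
  equation no longer describes \<open>z\<close>, the trajectory rests at \<open>1\<close>, as the scaled chain does after
  absorption.
\<close>

definition limit_trajectory :: "(real \<Rightarrow> real) \<Rightarrow> ereal \<Rightarrow> (real \<Rightarrow> real) \<Rightarrow> bool" where
  "limit_trajectory \<gamma> Tstar z \<longleftrightarrow>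
     first_time_at_one z Tstar \<and>
     z 0 = 0 \<and>
     (\<forall>t\<ge>0. ereal t \<le> Tstar \<longrightarrow>
        0 \<le> z t \<and>
        (z has_real_derivative 1 + \<gamma> (z t)) (at t within {s. 0 \<le> s \<and> ereal s \<le> Tstar})) \<and>
     (\<forall>t. Tstar < ereal t \<longrightarrow> z t = 1)"

end

theory Submission
  imports Defs
begin

text \<open>
  Along each path, the error is bounded by a Gronwall argument: the scaled chain is its compensator
  plus the martingale, and the drifts of the compensator and of \<open>z\<close> differ by at most \<open>\<delta>\<close> plus
  \<open>C\<^sub>L\<close> times the error. Hence the error up to time \<open>T\<close> is at most
  \<open>(\<delta> T + (1 + gammaN_bar) / N + max \<bar>M\<bar> / N) e\<^sup>C\<^sup>T\<close>. Minkowski's and Doob's inequalities turn this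
  into the \<open>L\<^sup>p\<close> bound, and for \<open>p = 2\<close> orthogonality of the increments bounds the second moment
  of \<open>M\<^sub>n\<close> by \<open>n\<close> times \<open>psiN_bar\<close>. Two points need care. After absorption of the chain \<open>\<gamma>\<close> is
  compared with the drift in state \<open>N - 1\<close>, at the price of a term \<open>1 / N\<close>, which the summand
  \<open>(1 + gammaN_bar) / N\<close> can absorb because it is then not spent on rounding the time. After \<open>Tstar\<close>
  the error can only decrease.
\<close>

section \<open>Doob's maximal inequality in discrete time\<close>

definition running_max :: "(nat \<Rightarrow> real) \<Rightarrow> nat \<Rightarrow> real" where
  "running_max s n = Max (s ` {..n})"

lemma running_max_0 [simp]: "running_max s 0 = s 0"
  by (simp add: running_max_def)

lemma running_max_Suc: "running_max s (Suc n) = max (running_max s n) (s (Suc n))"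
  by (simp add: running_max_def atMost_Suc max.commute)

lemma running_max_ge: "i \<le> n \<Longrightarrow> s i \<le> running_max s n"
  by (simp add: running_max_def)

lemma running_max_nonneg: "(\<And>i. 0 \<le> s i) \<Longrightarrow> 0 \<le> running_max s n"
  using running_max_ge[of 0 n s] by (meson order_trans zero_le)

lemma running_max_le: "(\<And>i. i \<le> n \<Longrightarrow> s i \<le> c) \<Longrightarrow> running_max s n \<le> c"
  by (simp add: running_max_def)

text \<open>Young's inequality with the conjugate exponents \<open>p / (p - 1)\<close> and
  \<open>p\<close>, applied to \<open>a powr (p - 1)\<close> and \<open>b\<close>.\<close>

lemma young_powr:
  fixes a b p :: real
  assumes "1 < p" "0 \<le> a" "0 \<le> b"
  shows "a powr (p - 1) * b \<le> (p - 1) / p * a powr p + b powr p / p"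
proof -
  have "a powr (p - 1) * b
      \<le> (a powr (p - 1)) powr (p / (p - 1)) / (p / (p - 1)) + b powr p / p"
    using assms by (intro Youngs_inequality) (auto simp: field_simps)
  also have "(a powr (p - 1)) powr (p / (p - 1)) = a powr p"
    using assms by (simp add: powr_powr)
  finally show ?thesis
    by (simp add: field_simps)
qed

text \<open>
  Summation by parts of \<open>\<Sum> S\<^sub>i\<^sup>p\<^sup>-\<^sup>1 (s\<^sub>i\<^sub>+\<^sub>1 - s\<^sub>i)\<close>, with \<open>S\<close> the running maximum: \<open>S\<close> grows only
  where \<open>S = s\<close>. For a submartingale \<open>s\<close> the left-hand side has nonnegative mean, which makes
  this the pathwise form of Doob's inequality.
\<close>

lemma sum_running_max_le:
  fixes s :: "nat \<Rightarrow> real" and p :: real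
  assumes p: "1 < p" and s: "\<And>i. 0 \<le> s i"
  shows "(\<Sum>i<n. running_max s i powr (p - 1) * (s (Suc i) - s i))
    \<le> running_max s n powr (p - 1) * s n - (p - 1) / p * running_max s n powr p"
proof (induction n)
  case 0
  have "s 0 powr (p - 1) * s 0 = s 0 powr p"
    using s[of 0] powr_mult_base[of "s 0" "p - 1"] by (simp add: mult.commute)
  then have "s 0 powr (p - 1) * s 0 - (p - 1) / p * s 0 powr p = s 0 powr p / p"
    using p by (simp add: field_simps)
  then show ?case using p by simp
next
  case (Suc n)
  let ?a = "running_max s n" and ?b = "s (Suc n)"
  \<comment> \<open>Passing to the new maximum can only increase the right-hand side: nothing
    changes unless \<open>?b\<close> exceeds \<open>?a\<close>, and in that case Young's inequality
    gives the comparison.\<close>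
  have step: "?a powr (p - 1) * ?b - (p - 1) / p * ?a powr p
      \<le> max ?a ?b powr (p - 1) * ?b - (p - 1) / p * max ?a ?b powr p"
  proof (cases "?b \<le> ?a")
    case False
    have "?b powr (p - 1) * ?b = ?b powr p"
      using s[of "Suc n"] powr_mult_base[of ?b "p - 1"] by (simp add: mult.commute)
    then have "?b powr (p - 1) * ?b - (p - 1) / p * ?b powr p = ?b powr p / p"
      using p by (simp add: field_simps)
    then show ?thesis
      using False young_powr[OF p running_max_nonneg[of s n, OF s] s[of "Suc n"]]
      by (simp add: max_def)
  qed (simp add: max_def)
  show ?case
    using Suc step by (simp add: running_max_Suc algebra_simps)
qed

text \<open>The summation by parts, multiplied by \<open>p / (p - 1)\<close>, leaves the mixed term
  \<open>S powr (p - 1) * (p / (p - 1) * s n)\<close>, with \<open>S\<close> the final maximum.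
  Young's inequality splits it, and a share \<open>1 / p\<close> of \<open>S powr p\<close> remains
  for the left-hand side.\<close>

lemma doob_pathwise:
  fixes s :: "nat \<Rightarrow> real" and p :: real
  assumes p: "1 < p" and s: "\<And>i. 0 \<le> s i"
  shows "running_max s n powr p
      + p * (p / (p - 1)) * (\<Sum>i<n. running_max s i powr (p - 1) * (s (Suc i) - s i))
    \<le> (p / (p - 1)) powr p * s n powr p"
proof -
  let ?S = "running_max s n" and ?q = "p / (p - 1)"
  have q: "0 < ?q" using p by simp
  have "?q * (\<Sum>i<n. running_max s i powr (p - 1) * (s (Suc i) - s i))
      \<le> ?q * (?S powr (p - 1) * s n - (p - 1) / p * ?S powr p)"
    using sum_running_max_le[OF p s] q by (intro mult_left_mono) auto
  also have "\<dots> = ?S powr (p - 1) * (?q * s n) - ?S powr p"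
    using p by (simp add: field_simps)
  also have "\<dots> \<le> (p - 1) / p * ?S powr p + (?q * s n) powr p / p - ?S powr p"
    using young_powr[OF p running_max_nonneg[of s n, OF s] mult_nonneg_nonneg[OF less_imp_le[OF q] s[of n]]]
    by simp
  also have "\<dots> = (?q powr p * s n powr p - ?S powr p) / p"
    using powr_mult[of ?q "s n" p] p by (simp add: field_simps)
  finally show ?thesis
    using p by (simp add: field_simps)
qed

text \<open>\<open>sgn a\<close> is a subgradient of the absolute value at \<open>a\<close>. This
  passes from increments of a martingale to increments of its absolute value without conditional
  expectations.\<close>

lemma abs_increment_ge: "sgn a * (b - a) \<le> \<bar>b\<bar> - \<bar>a\<bar>" for a b :: real
  by (auto simp: sgn_if abs_if)

section \<open>Martingale transforms, Doob's inequality and norm inequalities\<close>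

context prob_space
begin

text \<open>A factor known at time \<open>n\<close> can be pulled out of the conditional expectation
  given \<open>F n\<close>. Its boundedness keeps the products integrable.\<close>

lemma martingale_orthogonal:
  assumes mart: "is_martingale M F X"
    and H [measurable]: "H \<in> borel_measurable (F n)"
    and bounded: "AE \<omega> in M. \<bar>H \<omega>\<bar> \<le> c"
  shows "integrable M (\<lambda>\<omega>. H \<omega> * (X (Suc n) \<omega> - X n \<omega>))"
    and "(\<integral>\<omega>. H \<omega> * (X (Suc n) \<omega> - X n \<omega>) \<partial>M) = 0"
proof -
  have sub: "subalgebra M (F n)" and int: "\<And>k. integrable M (X k)"
    and cond: "AE \<omega> in M. real_cond_exp M (F n) (X (Suc n)) \<omega> = X n \<omega>"
    using mart by (auto simp: is_martingale_def)
  interpret finite_measure_subalgebra M "F n"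
    using sub by unfold_locales
  have HM [measurable]: "H \<in> borel_measurable M"
    using measurable_from_subalg[OF sub H] .
  have intH: "integrable M (\<lambda>\<omega>. H \<omega> * X k \<omega>)" for k
  proof (rule Bochner_Integration.integrable_bound)
    show "integrable M (\<lambda>\<omega>. c * X k \<omega>)" using int by simp
    show "AE \<omega> in M. norm (H \<omega> * X k \<omega>) \<le> norm (c * X k \<omega>)"
      using bounded by eventually_elim (auto simp: abs_mult intro!: mult_right_mono)
  qed (use int[of k] HM in measurable)
  have "(\<integral>\<omega>. H \<omega> * X (Suc n) \<omega> \<partial>M) = (\<integral>\<omega>. H \<omega> * real_cond_exp M (F n) (X (Suc n)) \<omega> \<partial>M)"
    using real_cond_exp_intg(2)[OF intH H, of "Suc n"] int by auto
  also have "\<dots> = (\<integral>\<omega>. H \<omega> * X n \<omega> \<partial>M)"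
    using cond int[of n] by (intro integral_cong_AE) (auto intro!: borel_measurable_times)
  finally show "(\<integral>\<omega>. H \<omega> * (X (Suc n) \<omega> - X n \<omega>) \<partial>M) = 0"
    using intH by (simp add: right_diff_distrib)
  show "integrable M (\<lambda>\<omega>. H \<omega> * (X (Suc n) \<omega> - X n \<omega>))"
    using intH by (simp add: right_diff_distrib)
qed

lemma integrable_AE_bounded:
  fixes f :: "'a \<Rightarrow> real"
  assumes "f \<in> borel_measurable M" "AE \<omega> in M. \<bar>f \<omega>\<bar> \<le> c"
  shows "integrable M f"
  using assms by (intro integrable_const_bound[where B = c]) auto

text \<open>The pathwise inequality is integrated. With weights \<open>?H\<close> known at each
  step, the sum \<open>?D\<close> of weighted martingale increments has mean zero and drops out. The
  almost sure bound \<open>c\<close> supplies the integrability.\<close>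

theorem doob_Lp:
  fixes p :: real
  assumes mart: "is_martingale M F X" and p: "1 < p"
    and bounded: "\<And>i. i \<le> n \<Longrightarrow> AE \<omega> in M. \<bar>X i \<omega>\<bar> \<le> c"
  shows "Lp_norm M p (\<lambda>\<omega>. running_max (\<lambda>i. \<bar>X i \<omega>\<bar>) n) \<le> p / (p - 1) * Lp_norm M p (X n)"
proof -
  let ?S = "\<lambda>i \<omega>. running_max (\<lambda>i. \<bar>X i \<omega>\<bar>) i" and ?q = "p / (p - 1)"
  let ?H = "\<lambda>i \<omega>. ?S i \<omega> powr (p - 1) * sgn (X i \<omega>)"
  have filt: "filtration (space M) F" and sub: "\<And>k. subalgebra M (F k)"
    and adapted: "\<And>k. X k \<in> borel_measurable (F k)"
    using mart by (auto simp: is_martingale_def)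
  have q: "0 < ?q" using p by simp
  have XF: "X i \<in> borel_measurable (F k)" if "i \<le> k" for i k
    using filtration.sets_F_mono[OF filt that] filtration.space_F[OF filt] adapted[of i]
    by (auto simp: measurable_def)
  have SF: "?S i \<in> borel_measurable (F k)" if "i \<le> k" for i k
    using that
  proof (induction i)
    case (Suc i)
    then show ?case
      using XF[of "Suc i" k] by (auto simp: running_max_Suc intro!: borel_measurable_max)
  qed (use XF[of 0 k] in auto)
  have XM [measurable]: "X i \<in> borel_measurable M" for i
    using measurable_from_subalg[OF sub adapted] .
  have SM [measurable]: "?S i \<in> borel_measurable M" for i
    using measurable_from_subalg[OF sub SF[OF order_refl]] .
  have S_nonneg: "0 \<le> ?S i \<omega>" for i \<omega>
    by (rule running_max_nonneg) auto
  have "AE \<omega> in M. \<forall>i\<in>{..n}. \<bar>X i \<omega>\<bar> \<le> c"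
    using bounded by (intro AE_finite_allI) auto
  then have S_le: "AE \<omega> in M. \<forall>i\<le>n. ?S i \<omega> \<le> c"
    by eventually_elim (auto intro!: running_max_le)
  have HF: "?H i \<in> borel_measurable (F i)" for i
    using SF[of i i] XF[of i i] unfolding sgn_if by measurable
  have H_le: "AE \<omega> in M. \<bar>?H i \<omega>\<bar> \<le> c powr (p - 1)" if "i \<le> n" for i
    using S_le
  proof eventually_elim
    case (elim \<omega>)
    then have "?S i \<omega> powr (p - 1) \<le> c powr (p - 1)"
      using that p S_nonneg by (intro powr_mono2) auto
    then show ?case
      using abs_sgn_eq[of "X i \<omega>"] by (auto simp: abs_mult)
  qed
  have intS: "integrable M (\<lambda>\<omega>. ?S n \<omega> powr p)"
  proof (rule integrable_AE_bounded)
    show "AE \<omega> in M. \<bar>?S n \<omega> powr p\<bar> \<le> c powr p"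
      using S_le by eventually_elim (use S_nonneg p in \<open>auto intro!: powr_mono2\<close>)
  qed measurable
  have intX: "integrable M (\<lambda>\<omega>. \<bar>X n \<omega>\<bar> powr p)"
  proof (rule integrable_AE_bounded)
    show "AE \<omega> in M. \<bar>\<bar>X n \<omega>\<bar> powr p\<bar> \<le> c powr p"
      using bounded[OF order_refl] by eventually_elim (use p in \<open>auto intro!: powr_mono2\<close>)
  qed measurable
  let ?D = "\<lambda>\<omega>. \<Sum>i<n. ?H i \<omega> * (X (Suc i) \<omega> - X i \<omega>)"
  note orth = martingale_orthogonal[OF mart HF H_le]
  have intD: "integrable M ?D" and D0: "(\<integral>\<omega>. ?D \<omega> \<partial>M) = 0"
    using orth by (auto simp: Bochner_Integration.integral_sum)
  have pathwise: "?S n \<omega> powr p + p * ?q * ?D \<omega> \<le> ?q powr p * \<bar>X n \<omega>\<bar> powr p" for \<omega>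
  proof -
    have "?D \<omega> \<le> (\<Sum>i<n. ?S i \<omega> powr (p - 1) * (\<bar>X (Suc i) \<omega>\<bar> - \<bar>X i \<omega>\<bar>))"
      using abs_increment_ge by (intro sum_mono) (simp add: mult.assoc mult_left_mono)
    then have "p * ?q * ?D \<omega>
        \<le> p * ?q * (\<Sum>i<n. ?S i \<omega> powr (p - 1) * (\<bar>X (Suc i) \<omega>\<bar> - \<bar>X i \<omega>\<bar>))"
      using p q by (intro mult_left_mono) auto
    then show ?thesis
      using doob_pathwise[OF p, of "\<lambda>i. \<bar>X i \<omega>\<bar>" n] by linarith
  qed
  have "(\<integral>\<omega>. ?S n \<omega> powr p \<partial>M) = (\<integral>\<omega>. ?S n \<omega> powr p + p * ?q * ?D \<omega> \<partial>M)"
    using intS intD D0 by simp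
  also have "\<dots> \<le> (\<integral>\<omega>. ?q powr p * \<bar>X n \<omega>\<bar> powr p \<partial>M)"
    using intS intD intX pathwise by (intro integral_mono) auto
  finally have "(\<integral>\<omega>. ?S n \<omega> powr p \<partial>M) \<le> ?q powr p * (\<integral>\<omega>. \<bar>X n \<omega>\<bar> powr p \<partial>M)"
    by simp
  then have "(\<integral>\<omega>. ?S n \<omega> powr p \<partial>M) powr (1 / p)
      \<le> (?q powr p * (\<integral>\<omega>. \<bar>X n \<omega>\<bar> powr p \<partial>M)) powr (1 / p)"
    using p by (intro powr_mono2) auto
  also have "\<dots> = ?q * (\<integral>\<omega>. \<bar>X n \<omega>\<bar> powr p \<partial>M) powr (1 / p)"
    using p q by (simp add: powr_mult powr_powr)
  finally show ?thesis
    using S_nonneg by (simp add: Lp_norm_def)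
qed

text \<open>Minkowski's inequality with a constant summand. It follows from convexity of the power,
  with weights \<open>c / (c + b)\<close> and \<open>b / (c + b)\<close>, where \<open>b\<close> is
  slightly larger than the norm of \<open>f\<close>.\<close>

lemma Lp_norm_const_add_le:
  fixes f :: "'a \<Rightarrow> real"
  assumes p: "1 < p" and c: "0 < c" and f: "\<And>\<omega>. 0 \<le> f \<omega>"
    and meas [measurable]: "f \<in> borel_measurable M" and bounded: "AE \<omega> in M. f \<omega> \<le> K"
  shows "Lp_norm M p (\<lambda>\<omega>. c + f \<omega>) \<le> c + Lp_norm M p f"
proof (rule field_le_epsilon)
  fix e :: real
  assume e: "0 < e"
  define I where "I = (\<integral>\<omega>. f \<omega> powr p \<partial>M)"
  \<comment> \<open>The added \<open>e\<close> keeps \<open>b\<close> positive even when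
    \<open>f\<close> vanishes almost everywhere, so that dividing by it is legitimate.\<close>
  define b where "b = I powr (1 / p) + e"
  have I: "0 \<le> I" unfolding I_def by simp
  have b: "0 < b" using e by (simp add: b_def add_nonneg_pos)
  have "I = (I powr (1 / p)) powr p"
    using p I by (simp add: powr_powr)
  also have "\<dots> \<le> b powr p"
    using p e by (intro powr_mono2) (auto simp: b_def)
  finally have Ib: "I \<le> b powr p" .
  have intf: "integrable M (\<lambda>\<omega>. f \<omega> powr p)"
  proof (rule integrable_AE_bounded)
    show "AE \<omega> in M. \<bar>f \<omega> powr p\<bar> \<le> K powr p"
      using bounded by eventually_elim (use p f in \<open>auto intro!: powr_mono2\<close>)
  qed measurable
  have intcf: "integrable M (\<lambda>\<omega>. (c + f \<omega>) powr p)"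
  proof (rule integrable_AE_bounded)
    show "AE \<omega> in M. \<bar>(c + f \<omega>) powr p\<bar> \<le> (c + K) powr p"
      using bounded by eventually_elim (use p c f in \<open>auto intro!: powr_mono2 add_nonneg_nonneg\<close>)
  qed measurable
  have convex: "(c + f \<omega>) powr p
      \<le> (c + b) powr p * (c / (c + b) + b / (c + b) * (f \<omega> powr p / b powr p))" for \<omega>
  proof -
    have "(c + f \<omega>) / (c + b) = c / (c + b) * 1 + b / (c + b) * (f \<omega> / b)"
      using b by (simp add: add_divide_distrib)
    moreover have "(c / (c + b) * 1 + b / (c + b) * (f \<omega> / b)) powr p
        \<le> c / (c + b) * (1 powr p) + b / (c + b) * ((f \<omega> / b) powr p)"
    \<comment> \<open>Convexity is applied on the open half-line. At zero it remains to see that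
      raising a number in the unit interval to the power \<open>p\<close> does not increase
      it.\<close>
    proof (cases "f \<omega> = 0")
      case True
      have "(c / (c + b)) powr p \<le> (c / (c + b)) powr 1"
        using p b c by (intro powr_mono') auto
      then show ?thesis using True b c p by simp
    next
      case False
      have "c / (c + b) = 1 - b / (c + b)"
        using b c by (simp add: field_simps)
      then show ?thesis
        using convex_onD[OF powr_convex, of p "b / (c + b)" 1 "f \<omega> / b"] p b c f[of \<omega>] False
        by (simp add: less_le)
    qed
    ultimately have "((c + f \<omega>) / (c + b)) powr p
        \<le> c / (c + b) + b / (c + b) * (f \<omega> powr p / b powr p)"
      using b f[of \<omega>] by (simp add: powr_divide)
    then show ?thesis
      using b c f[of \<omega>] by (simp add: powr_divide pos_divide_le_eq mult.commute)
  qed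
  have "(\<integral>\<omega>. (c + f \<omega>) powr p \<partial>M)
      \<le> (\<integral>\<omega>. (c + b) powr p * (c / (c + b) + b / (c + b) * (f \<omega> powr p / b powr p)) \<partial>M)"
    using intcf intf convex by (intro integral_mono) auto
  also have "\<dots> = (c + b) powr p * (c / (c + b) + b / (c + b) * (I / b powr p))"
    using intf by (simp add: I_def prob_space)
  also have "\<dots> \<le> (c + b) powr p * (c / (c + b) + b / (c + b) * 1)"
    using b c Ib by (intro mult_left_mono add_left_mono) auto
  also have "\<dots> = (c + b) powr p"
    using b c by (simp flip: add_divide_distrib)
  finally have "(\<integral>\<omega>. (c + f \<omega>) powr p \<partial>M) powr (1 / p) \<le> ((c + b) powr p) powr (1 / p)"
    using p by (intro powr_mono2) auto
  also have "\<dots> = c + b"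
    using p b c by (simp add: powr_powr)
  finally show "Lp_norm M p (\<lambda>\<omega>. c + f \<omega>) \<le> c + Lp_norm M p f + e"
    using c f by (simp add: Lp_norm_def b_def I_def)
qed

text \<open>Integrability is asked of \<open>g\<close> alone, because \<open>f\<close> will be a
  supremum over an uncountable time interval. If the power of \<open>f\<close> is not integrable,
  its integral is \<open>0\<close> by convention and the bound still holds.\<close>

lemma Lp_norm_mono:
  assumes "0 < p" and "AE \<omega> in M. \<bar>f \<omega>\<bar> \<le> g \<omega>" and "integrable M (\<lambda>\<omega>. \<bar>g \<omega>\<bar> powr p)"
  shows "Lp_norm M p f \<le> Lp_norm M p g"
proof -
  have "(\<integral>\<omega>. \<bar>f \<omega>\<bar> powr p \<partial>M) \<le> (\<integral>\<omega>. \<bar>g \<omega>\<bar> powr p \<partial>M)"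
  proof (rule integral_mono_AE'[OF assms(3)])
    show "AE \<omega> in M. \<bar>f \<omega>\<bar> powr p \<le> \<bar>g \<omega>\<bar> powr p"
      using assms(2) by eventually_elim (use \<open>0 < p\<close> in \<open>auto intro!: powr_mono2\<close>)
  qed simp
  then show ?thesis
    unfolding Lp_norm_def using \<open>0 < p\<close> by (intro powr_mono2) auto
qed

lemma Lp_norm_mult:
  assumes "0 < p" "0 \<le> c"
  shows "Lp_norm M p (\<lambda>\<omega>. c * f \<omega>) = c * Lp_norm M p f"
  using assms by (simp add: Lp_norm_def abs_mult powr_mult powr_powr)

end

section \<open>Paths of the chain and the limit\<close>

lemma increment_le_exp:
  fixes f :: "real \<Rightarrow> real"
  assumes "a \<le> b" and cont: "continuous_on {a..b} f"
    and deriv: "\<And>s. a < s \<Longrightarrow> s < b \<Longrightarrow> (f has_real_derivative D s) (at s)"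
    and bound: "\<And>s. a < s \<Longrightarrow> s < b \<Longrightarrow> D s \<le> d + C * (B * exp (C * s))"
  shows "f b - f a \<le> d * (b - a) + B * (exp (C * b) - exp (C * a))"
proof -
  \<comment> \<open>\<open>d * s + B * exp (C * s)\<close> is an antiderivative of the drift bound,
    so subtracting it leaves a nonincreasing function.\<close>
  let ?h = "\<lambda>s. f s - d * s - B * exp (C * s)"
  have "?h b \<le> ?h a"
  proof (rule DERIV_nonpos_imp_decreasing_open[OF \<open>a \<le> b\<close>])
    fix s assume s: "a < s" "s < b"
    have "(?h has_real_derivative D s - d - C * (B * exp (C * s))) (at s)"
      by (rule derivative_eq_intros deriv[OF s] refl | simp)+
    then show "\<exists>y. (?h has_real_derivative y) (at s) \<and> y \<le> 0"
      using bound[OF s] by (intro exI[of _ "D s - d - C * (B * exp (C * s))"]) auto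
  qed (intro continuous_intros cont)
  then show ?thesis by (simp add: algebra_simps)
qed

text \<open>
  Gronwall's inequality with its integral condition \<open>w t \<le> A + C \<integral>\<^sub>0\<^sup>t w\<close> replaced by a consequence
  that needs no integrability. With \<open>B\<close> the supremum of \<open>w t e\<^sup>-\<^sup>C\<^sup>t\<close>, the premise bounds
  \<open>w t e\<^sup>-\<^sup>C\<^sup>t\<close> by \<open>B - (B - A) e\<^sup>-\<^sup>C\<^sup>t\<close>, so that \<open>A < B\<close> is impossible.
\<close>

lemma gronwall_exp_bound:
  fixes w :: "real \<Rightarrow> real"
  assumes T: "0 \<le> T" and C: "0 \<le> C" and t: "t \<in> {0..T}"
    and bounded: "\<And>s. s \<in> {0..T} \<Longrightarrow> 0 \<le> w s \<and> w s \<le> K"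
    and step: "\<And>B s. 0 \<le> B \<Longrightarrow> (\<And>u. u \<in> {0..T} \<Longrightarrow> w u \<le> B * exp (C * u)) \<Longrightarrow> s \<in> {0..T}
      \<Longrightarrow> w s \<le> A + B * (exp (C * s) - 1)"
  shows "w t \<le> A * exp (C * t)"
proof -
  let ?r = "\<lambda>s. w s * exp (- (C * s))"
  define B where "B = (SUP s\<in>{0..T}. ?r s)"
  have r_le: "?r s \<le> K" if "s \<in> {0..T}" for s
  proof -
    have "?r s \<le> w s * 1"
      using that C bounded[OF that] by (intro mult_left_mono) auto
    then show ?thesis using bounded[OF that] by simp
  qed
  have bdd: "bdd_above (?r ` {0..T})"
    using r_le by (rule bdd_aboveI2)
  have r_B: "?r s \<le> B" if "s \<in> {0..T}" for s
    unfolding B_def using that bdd by (rule cSUP_upper)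
  have w_B: "w s \<le> B * exp (C * s)" if "s \<in> {0..T}" for s
    using r_B[OF that] by (simp add: exp_minus field_simps)
  have "0 \<le> ?r 0" using bounded[of 0] T by simp
  also have "\<dots> \<le> B" using r_B[of 0] T by simp
  finally have B: "0 \<le> B" .
  have "B \<le> A"
  proof (rule ccontr)
    assume "\<not> B \<le> A"
    \<comment> \<open>Replacing \<open>s\<close> by \<open>T\<close> in the exponent makes the bound
      uniform, so it passes to the supremum and places \<open>B\<close> strictly below
      itself.\<close>
    have "?r s \<le> B - (B - A) * exp (- (C * T))" if "s \<in> {0..T}" for s
    proof -
      have "?r s \<le> (A + B * (exp (C * s) - 1)) * exp (- (C * s))"
        using step[OF B w_B that] by simp
      also have "\<dots> = B - (B - A) * exp (- (C * s))"
        by (simp add: exp_minus field_simps)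
      also have "\<dots> \<le> B - (B - A) * exp (- (C * T))"
        using \<open>\<not> B \<le> A\<close> that C by (intro diff_left_mono mult_left_mono) (auto intro: mult_left_mono)
      finally show ?thesis .
    qed
    then have "B \<le> B - (B - A) * exp (- (C * T))"
      unfolding B_def using T by (intro cSUP_least) auto
    moreover have "0 < (B - A) * exp (- (C * T))"
      using \<open>\<not> B \<le> A\<close> by simp
    ultimately show False by simp
  qed
  then show ?thesis
    using w_B[OF t] by (meson exp_ge_zero mult_right_mono order_trans)
qed

section \<open>Deterministic analysis of a single path\<close>

locale explored_path =
  fixes N :: nat and g \<gamma> :: "_ \<Rightarrow> real" and x :: "nat \<Rightarrow> nat" and z :: "real \<Rightarrow> real"
    and C \<delta> G m T :: real
  assumes N_pos: "0 < N"
    and x_0: "x 0 = 0"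
    and x_le: "\<And>n. x n \<le> N"
    and x_mono: "\<And>n. x n \<le> x (Suc n)"
    and lipschitz: "C-lipschitz_on {0..} \<gamma>"
    and approx: "\<And>k. k < N \<Longrightarrow> \<bar>g k - \<gamma> (real k / real N)\<bar> \<le> \<delta>"
    and g_nonneg: "\<And>k. k < N \<Longrightarrow> 0 \<le> g k"
    and g_le: "\<And>k. k < N \<Longrightarrow> g k \<le> G"
    and T: "0 \<le> T"
    and comp_bound: "\<And>n. n \<le> nat \<lfloor>T * real N\<rfloor> \<Longrightarrow>
      \<bar>real (x n) - (\<Sum>i | i < n \<and> x i < N. 1 + g (x i))\<bar> \<le> m * real N"
    and z_0: "z 0 = 0"
    and z_cont: "continuous_on {0..T} z"
    and z_deriv: "\<And>s. 0 < s \<Longrightarrow> s < T \<Longrightarrow> (z has_real_derivative 1 + \<gamma> (z s)) (at s)"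
    and z_range: "\<And>s. s \<in> {0..T} \<Longrightarrow> 0 \<le> z s \<and> z s \<le> 1"
begin

text \<open>The value of the martingale along the path. The locale bounds it by
  \<open>m * real N\<close> for all steps up to time \<open>T\<close>.\<close>

definition comp :: "nat \<Rightarrow> real" where
  "comp n = real (x n) - (\<Sum>i | i < n \<and> x i < N. 1 + g (x i))"

definition step_at :: "real \<Rightarrow> nat" where
  "step_at s = nat \<lfloor>s * real N\<rfloor>"

text \<open>
  The extra \<open>1 / N\<close> after absorption serves the comparison of the drift with \<open>\<gamma>\<close>: the hypothesis
  on \<open>\<gamma>\<close> says nothing about the absorbing state, and the last state it covers is \<open>N - 1\<close>.
\<close>

definition err :: "real \<Rightarrow> real" where
  "err s = \<bar>real (x (step_at s)) / real N - z s\<bar> + (if x (step_at s) = N then 1 / real N else 0)"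

lemma C_nonneg: "0 \<le> C"
  using lipschitz by (rule lipschitz_on_nonneg)

lemma \<delta>_nonneg: "0 \<le> \<delta>"
  using approx[OF N_pos] by linarith

lemma G_nonneg: "0 \<le> G"
  using g_nonneg[OF N_pos] g_le[OF N_pos] by linarith

lemma comp_0: "comp 0 = 0"
  by (simp add: comp_def x_0)

text \<open>The recursion is stated for the difference of \<open>x\<close> and \<open>comp\<close>,
  the compensator, since it moves by the drift alone and can be compared with \<open>z\<close> cell
  by cell.\<close>

lemma compensator_Suc:
  "real (x (Suc n)) - comp (Suc n) = real (x n) - comp n + (if x n < N then 1 + g (x n) else 0)"
proof -
  have "{i. i < Suc n \<and> x i < N} =
      (if x n < N then insert n {i. i < n \<and> x i < N} else {i. i < n \<and> x i < N})"
    by (auto simp: less_Suc_eq)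
  then show ?thesis by (simp add: comp_def)
qed

lemma comp_le: "n \<le> step_at T \<Longrightarrow> \<bar>comp n\<bar> \<le> m * real N"
  using comp_bound by (simp add: comp_def step_at_def)

lemma step_at_eq: "real n / real N \<le> s \<Longrightarrow> s < real (Suc n) / real N \<Longrightarrow> step_at s = n"
  using N_pos by (auto simp: step_at_def field_simps nat_eq_iff floor_eq_iff)

lemma step_at_bounds:
  "0 \<le> s \<Longrightarrow> real (step_at s) / real N \<le> s \<and> s < real (Suc (step_at s)) / real N"
  using N_pos by (auto simp: step_at_def field_simps) linarith+

lemma step_at_mono: "s \<le> t \<Longrightarrow> step_at s \<le> step_at t"
  using N_pos by (auto simp: step_at_def intro!: nat_mono floor_mono mult_right_mono)

lemma lipschitz_abs: "0 \<le> u \<Longrightarrow> 0 \<le> v \<Longrightarrow> \<bar>\<gamma> u - \<gamma> v\<bar> \<le> C * \<bar>u - v\<bar>"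
  using lipschitz_onD[OF lipschitz, of u v] by (simp add: dist_real_def)

text \<open>The premise on \<open>B\<close> is the one under which \<open>gronwall_exp_bound\<close>
  asks for its step. Everything up to \<open>err_step\<close> is derived from it.\<close>

context
  fixes B :: real
  assumes err_le: "\<And>s. s \<in> {0..T} \<Longrightarrow> err s \<le> B * exp (C * s)"
begin

lemma drift_le:
  assumes s: "0 \<le> s" "s \<le> T" and n: "step_at s = n" "x n < N"
  shows "\<bar>\<gamma> (z s) - g (x n)\<bar> \<le> \<delta> + C * (B * exp (C * s))"
proof -
  have "\<bar>\<gamma> (z s) - \<gamma> (real (x n) / real N)\<bar> \<le> C * \<bar>z s - real (x n) / real N\<bar>"
    using z_range[of s] s by (intro lipschitz_abs) auto
  also have "\<dots> \<le> C * (B * exp (C * s))"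
    using err_le[of s] s n C_nonneg by (intro mult_left_mono) (auto simp: err_def abs_minus_commute)
  finally show ?thesis
    using approx[OF n(2)] by linarith
qed

text \<open>In the absorbed state only a decrease of \<open>z\<close> could hurt. At the last live
  state, \<open>\<gamma>\<close> is at least \<open>- \<delta>\<close>, and the distance of
  \<open>z s\<close> from \<open>real (N - 1) / real N\<close> is at most \<open>err s\<close>,
  thanks to the extra \<open>1 / N\<close> in \<open>err\<close>.\<close>

lemma absorbed_drift_le:
  assumes s: "0 \<le> s" "s \<le> T" and n: "step_at s = n" "x n = N"
  shows "- (1 + \<gamma> (z s)) \<le> \<delta> + C * (B * exp (C * s))"
proof -
  have "\<bar>\<gamma> (z s) - \<gamma> (real (N - 1) / real N)\<bar> \<le> C * \<bar>z s - real (N - 1) / real N\<bar>"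
    using z_range[of s] s by (intro lipschitz_abs) auto
  also have "\<dots> \<le> C * (B * exp (C * s))"
  proof (intro mult_left_mono C_nonneg)
    have "real (N - 1) / real N = 1 - 1 / real N"
      using N_pos by (simp add: of_nat_diff field_simps)
    moreover have "err s = \<bar>1 - z s\<bar> + 1 / real N"
      using n N_pos by (simp add: err_def)
    moreover have "0 < 1 / real N" using N_pos by simp
    ultimately have "\<bar>z s - real (N - 1) / real N\<bar> \<le> err s"
      by linarith
    then show "\<bar>z s - real (N - 1) / real N\<bar> \<le> B * exp (C * s)"
      using err_le[of s] s by simp
  qed
  finally show ?thesis
    using approx[of "N - 1"] g_nonneg[of "N - 1"] N_pos by simp
qed

text \<open>Between two grid points the chain stays in the state \<open>x n\<close>, so the
  pointwise drift bounds integrate. The upper bound on the growth of \<open>z\<close> is restricted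
  to live states, because after absorption \<open>z\<close> may still rise towards
  \<open>1\<close>.\<close>

lemma increment:
  assumes ab: "real n / real N \<le> a" "a \<le> b" "b \<le> real (Suc n) / real N" "b \<le> T"
  shows "x n < N \<Longrightarrow> z b - z a
      \<le> (1 + g (x n) + \<delta>) * (b - a) + B * (exp (C * b) - exp (C * a))"
    and "z a - z b
      \<le> (\<delta> - (if x n < N then 1 + g (x n) else 0)) * (b - a) + B * (exp (C * b) - exp (C * a))"
proof -
  have a: "0 \<le> a" using ab(1) by (meson divide_nonneg_nonneg of_nat_0_le_iff order_trans)
  have cont: "continuous_on {a..b} z"
    using z_cont by (rule continuous_on_subset) (use a ab in auto)
  have deriv: "(z has_real_derivative 1 + \<gamma> (z s)) (at s)" if "a < s" "s < b" for s
    using that a ab by (intro z_deriv) auto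
  have n: "step_at s = n" if "a < s" "s < b" for s
    using that ab by (intro step_at_eq) auto
  show "z b - z a \<le> (1 + g (x n) + \<delta>) * (b - a) + B * (exp (C * b) - exp (C * a))"
    if "x n < N"
  proof (rule increment_le_exp[OF ab(2) cont deriv])
    fix s assume s: "a < s" "s < b"
    then show "1 + \<gamma> (z s) \<le> 1 + g (x n) + \<delta> + C * (B * exp (C * s))"
      using drift_le[of s n] that a ab(4) n[OF s] by auto
  qed
  \<comment> \<open>The same integration applied to \<open>- z\<close>. In the absorbed state the
    compensator has drift \<open>0\<close>, and \<open>absorbed_drift_le\<close> supplies the
    bound.\<close>
  have "- z b - - z a
    \<le> (\<delta> - (if x n < N then 1 + g (x n) else 0)) * (b - a) + B * (exp (C * b) - exp (C * a))"
  proof (rule increment_le_exp[OF ab(2)])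
    fix s assume s: "a < s" "s < b"
    show "((\<lambda>s. - z s) has_real_derivative - (1 + \<gamma> (z s))) (at s)"
      using deriv[OF s] by (rule DERIV_minus)
    show "- (1 + \<gamma> (z s))
        \<le> \<delta> - (if x n < N then 1 + g (x n) else 0) + C * (B * exp (C * s))"
      using drift_le[of s n] absorbed_drift_le[of s n] s a ab(4) n[OF s] x_le[of n] by auto
  qed (intro continuous_intros cont)
  then show "z a - z b
    \<le> (\<delta> - (if x n < N then 1 + g (x n) else 0)) * (b - a) + B * (exp (C * b) - exp (C * a))"
    by simp
qed

text \<open>Over a full cell of length \<open>1 / N\<close> the error terms become increments of
  \<open>\<delta> * t + B * exp (C * t)\<close>, which telescope in the inductions that
  follow.\<close>

lemma grid_increment:
  defines "t \<equiv> \<lambda>n. real n / real N"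
  assumes n: "t (Suc n) \<le> T"
  shows "x n < N \<Longrightarrow> z (t (Suc n)) - z (t n)
      \<le> (1 + g (x n)) / real N + (\<delta> * t (Suc n) + B * exp (C * t (Suc n)))
        - (\<delta> * t n + B * exp (C * t n))"
    and "z (t n) - z (t (Suc n))
      \<le> - (if x n < N then 1 + g (x n) else 0) / real N
        + (\<delta> * t (Suc n) + B * exp (C * t (Suc n))) - (\<delta> * t n + B * exp (C * t n))"
proof -
  have le: "t n \<le> t (Suc n)"
    by (simp add: t_def divide_right_mono)
  have gap: "t (Suc n) - t n = 1 / real N"
    by (simp add: t_def add_divide_distrib)
  have \<delta>_gap: "\<delta> / real N = \<delta> * t (Suc n) - \<delta> * t n"
    using gap by (simp flip: right_diff_distrib)
  have bounds: "real n / real N \<le> t n" "t (Suc n) \<le> real (Suc n) / real N"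
    by (simp_all add: t_def)
  show "z (t (Suc n)) - z (t n)
      \<le> (1 + g (x n)) / real N + (\<delta> * t (Suc n) + B * exp (C * t (Suc n)))
        - (\<delta> * t n + B * exp (C * t n))" if "x n < N"
  proof -
    have "z (t (Suc n)) - z (t n)
        \<le> (1 + g (x n)) / real N + \<delta> / real N + (B * exp (C * t (Suc n)) - B * exp (C * t n))"
      using increment(1)[OF bounds(1) le bounds(2) n that]
      by (simp add: gap right_diff_distrib add_divide_distrib)
    then show ?thesis using \<delta>_gap by linarith
  qed
  have "z (t n) - z (t (Suc n)) \<le> \<delta> / real N - (if x n < N then 1 + g (x n) else 0) / real N
      + (B * exp (C * t (Suc n)) - B * exp (C * t n))"
    using increment(2)[OF bounds(1) le bounds(2) n]
    by (simp only: gap right_diff_distrib diff_divide_distrib mult_1_right times_divide_eq_right)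
  then show "z (t n) - z (t (Suc n))
      \<le> - (if x n < N then 1 + g (x n) else 0) / real N
        + (\<delta> * t (Suc n) + B * exp (C * t (Suc n))) - (\<delta> * t n + B * exp (C * t n))"
    using \<delta>_gap by linarith
qed

lemma grid_upper:
  "real n / real N \<le> T \<Longrightarrow> (real (x n) - comp n) / real N - z (real n / real N)
    \<le> \<delta> * (real n / real N) + B * exp (C * (real n / real N)) - B"
proof (induction n)
  case 0
  then show ?case by (simp add: x_0 comp_0 z_0)
next
  case (Suc n)
  have "real n / real N \<le> real (Suc n) / real N"
    by (simp add: divide_right_mono)
  then show ?case
    using Suc.IH Suc.prems grid_increment(2)[OF Suc.prems]
    unfolding compensator_Suc add_divide_distrib by linarith
qed

text \<open>Being live at step \<open>n\<close> passes to all earlier steps by monotonicity, so the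
  induction stays within live states. After absorption \<open>z \<le> 1\<close> takes over the role
  of this bound.\<close>

lemma grid_lower:
  "real n / real N \<le> T \<Longrightarrow> x n < N \<Longrightarrow> z (real n / real N) - (real (x n) - comp n) / real N
    \<le> \<delta> * (real n / real N) + B * exp (C * (real n / real N)) - B"
proof (induction n)
  case 0
  then show ?case by (simp add: x_0 comp_0 z_0)
next
  case (Suc n)
  have "real n / real N \<le> real (Suc n) / real N"
    by (simp add: divide_right_mono)
  moreover have "x n < N" using Suc.prems(2) x_mono[of n] by simp
  ultimately show ?case
    using Suc.IH Suc.prems(1) grid_increment(1)[OF Suc.prems(1)]
      compensator_Suc[of n] add_divide_distrib[of "real (x n) - comp n" "1 + g (x n)" "real N"]
    by simp
qed

text \<open>The grid bounds lead to the last grid point before or at \<open>t\<close>, and one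
  partial cell leads on to \<open>t\<close>. In a live state \<open>(1 + G) / N\<close> pays for
  that cell; in the absorbed state it pays for the \<open>1 / N\<close> in
  \<open>err\<close>.\<close>

lemma err_step:
  assumes t: "t \<in> {0..T}"
  shows "err t \<le> \<delta> * T + (1 + G) / real N + m + B * (exp (C * t) - 1)"
proof -
  define n where "n = step_at t"
  let ?a = "real n / real N"
  have a: "?a \<le> t" "t < real (Suc n) / real N"
    using step_at_bounds[of t] t by (auto simp: n_def)
  have aT: "?a \<le> T" using a t by auto
  have "step_at t \<le> step_at T"
    using t by (intro step_at_mono) auto
  then have "\<bar>comp n / real N\<bar> \<le> m"
    using comp_le[of n] N_pos by (simp add: n_def pos_divide_le_eq)
  moreover have \<delta>t: "\<delta> * t \<le> \<delta> * T"
    using t \<delta>_nonneg by (intro mult_left_mono) auto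
  moreover have upper: "real (x n) / real N - z ?a
      \<le> comp n / real N + \<delta> * ?a + (B * exp (C * ?a) - B)"
    using grid_upper[OF aT] by (simp add: diff_divide_distrib)
  moreover have down: "z ?a - z t
      \<le> \<delta> * (t - ?a) - (if x n < N then 1 + g (x n) else 0) * (t - ?a)
        + B * (exp (C * t) - exp (C * ?a))"
    using increment(2)[of n ?a t] a t by (simp add: left_diff_distrib)
  have split: "\<delta> * (t - ?a) = \<delta> * t - \<delta> * ?a"
    "B * (exp (C * t) - exp (C * ?a)) = B * exp (C * t) - B * exp (C * ?a)"
    "B * (exp (C * t) - 1) = B * exp (C * t) - B"
    by (simp_all add: right_diff_distrib)
  show ?thesis
  proof (cases "x n < N")
    case True
    \<comment> \<open>The cost of rounding the time: the limit keeps drifting during the cell while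
      the chain waits for its next jump.\<close>
    have "(1 + g (x n)) * (t - ?a) \<le> (1 + G) / real N"
      unfolding divide_inverse[of "1 + G"] using a g_le[OF True] G_nonneg 
      by (intro mult_mono) (auto simp: add_divide_distrib inverse_eq_divide)
    moreover have "0 \<le> (1 + g (x n)) * (t - ?a)"
      using a g_nonneg[OF True] by simp
    moreover have "0 \<le> (1 + G) / real N"
      using G_nonneg by simp
    moreover have "z ?a - real (x n) / real N
        \<le> - (comp n / real N) + \<delta> * ?a + (B * exp (C * ?a) - B)"
      using grid_lower[OF aT True] by (simp add: diff_divide_distrib)
    moreover have "z t - z ?a \<le> (1 + g (x n)) * (t - ?a) + \<delta> * (t - ?a)
        + B * (exp (C * t) - exp (C * ?a))"
      using increment(1)[of n ?a t] a t True by (simp add: distrib_right)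
    moreover have "err t = \<bar>real (x n) / real N - z t\<bar>"
      using True by (simp add: err_def flip: n_def)
    moreover have "z ?a - z t \<le> \<delta> * (t - ?a) - (1 + g (x n)) * (t - ?a)
        + B * (exp (C * t) - exp (C * ?a))"
      using down True by simp
    ultimately show ?thesis
      using \<open>\<bar>comp n / real N\<bar> \<le> m\<close> upper \<delta>t unfolding split by linarith
  next
    case False
    then have N: "x n = N" using x_le[of n] by simp
    then have "real (x n) / real N = 1"
      using N_pos by simp
    moreover from this have "err t = real (x n) / real N - z t + 1 / real N"
      using N z_range[OF t] by (simp add: err_def flip: n_def)
    moreover have "1 / real N \<le> (1 + G) / real N"
      using G_nonneg by (intro divide_right_mono) auto
    moreover have "z ?a - z t \<le> \<delta> * (t - ?a) + B * (exp (C * t) - exp (C * ?a))"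
      using down False by simp
    ultimately show ?thesis
      using \<open>\<bar>comp n / real N\<bar> \<le> m\<close> upper \<delta>t unfolding split by linarith
  qed
qed

end

text \<open>Gronwall's inequality applied to \<open>err\<close>. Both the scaled path and
  \<open>z\<close> lie in the unit interval and \<open>1 / N\<close> is at most \<open>1\<close>,
  which gives the a priori bound \<open>2\<close>.\<close>

lemma path_error:
  assumes t: "t \<in> {0..T}"
  shows "\<bar>real (x (step_at t)) / real N - z t\<bar> \<le> (\<delta> * T + (1 + G) / real N + m) * exp (C * t)"
proof -
  have "err t \<le> (\<delta> * T + (1 + G) / real N + m) * exp (C * t)"
  proof (rule gronwall_exp_bound[OF T C_nonneg t])
    fix s assume s: "s \<in> {0..T}"
    have "0 \<le> real (x (step_at s)) / real N" "real (x (step_at s)) / real N \<le> 1"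
      using N_pos x_le by simp_all
    moreover have "0 \<le> 1 / real N" "1 / real N \<le> 1" using N_pos by simp_all
    ultimately show "0 \<le> err s \<and> err s \<le> 2"
      using z_range[OF s] unfolding err_def by (split if_split) linarith
  qed (rule err_step)
  moreover have "\<bar>real (x (step_at t)) / real N - z t\<bar> \<le> err t"
    by (simp add: err_def)
  ultimately show ?thesis by simp
qed

end

section \<open>The limit trajectory up to and after \<open>Tstar\<close>\<close>

lemma limit_trajectory_bounds:
  assumes limit: "limit_trajectory \<gamma> Tstar z"
  shows "continuous_on {t. 0 \<le> t \<and> ereal t \<le> Tstar} z"
    and "0 \<le> t \<Longrightarrow> ereal t \<le> Tstar \<Longrightarrow> 0 \<le> z t \<and> z t \<le> 1"
    and "0 < t \<Longrightarrow> ereal t < Tstar \<Longrightarrow> (z has_real_derivative 1 + \<gamma> (z t)) (at t)"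
proof -
  let ?I = "{t. 0 \<le> t \<and> ereal t \<le> Tstar}"
  have deriv: "(z has_real_derivative 1 + \<gamma> (z t)) (at t within ?I)" if "t \<in> ?I" for t
    using limit that by (auto simp: limit_trajectory_def)
  show cont: "continuous_on ?I z"
    using deriv by (rule DERIV_continuous_on)
  show "0 \<le> z t \<and> z t \<le> 1" if t: "0 \<le> t" "ereal t \<le> Tstar" for t
  proof
    show "0 \<le> z t" using limit t by (auto simp: limit_trajectory_def)
    \<comment> \<open>A value above \<open>1\<close> would force, by continuity from
      \<open>z 0 = 0\<close>, a visit to \<open>1\<close> strictly before \<open>t\<close>, hence
      before \<open>Tstar\<close>.\<close>
    show "z t \<le> 1"
    proof (rule ccontr)
      assume "\<not> z t \<le> 1"
      moreover have "continuous_on {0..t} z"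
        using cont by (rule continuous_on_subset) (use t order_trans[of "ereal _" "ereal t" Tstar] in auto)
      ultimately obtain s where s: "0 \<le> s" "s \<le> t" "z s = 1"
        using IVT'[of z 0 1 t] limit t by (auto simp: limit_trajectory_def)
      then have "s < t" using \<open>\<not> z t \<le> 1\<close> by (cases "s = t") auto
      then have "ereal s < Tstar"
        using t(2) by (meson ereal_less_eq(3) less_ereal.simps(1) less_le_trans)
      then show False
        using limit s by (auto simp: limit_trajectory_def first_time_at_one_def)
    qed
  qed
  show "(z has_real_derivative 1 + \<gamma> (z t)) (at t)" if t: "0 < t" "ereal t < Tstar" for t
  proof -
    \<comment> \<open>A real number between \<open>t\<close> and \<open>Tstar\<close>, which exists
      also for infinite \<open>Tstar\<close>, yields an open interval around \<open>t\<close> inside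
      \<open>?I\<close>, so the derivative within \<open>?I\<close> is two-sided.\<close>
    obtain r where r: "t < r" "ereal r < Tstar"
      using ereal_dense2[OF t(2)] by auto
    have "{0<..<r} \<subseteq> ?I"
    proof
      fix s
      assume s: "s \<in> {0<..<r}"
      then have "ereal s \<le> ereal r" by simp
      also have "\<dots> \<le> Tstar" using r(2) by simp
      finally show "s \<in> ?I" using s by simp
    qed
    then have "at t within ?I = at t"
      using r t by (intro at_within_open_subset[of t "{0<..<r}"]) auto
    then show ?thesis
      using deriv[of t] t by auto
  qed
qed

lemma limit_trajectory_after:
  assumes "limit_trajectory \<gamma> Tstar z" "Tstar \<le> ereal t"
  shows "z t = 1"
  using assms
  by (cases "Tstar = ereal t")
    (auto simp: limit_trajectory_def first_time_at_one_def less_le)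

text \<open>
  After \<open>Tstar\<close> the limit rests at \<open>1\<close> while the path increases towards it, so the error there
  is at most the error at \<open>Tstar\<close>.
\<close>

lemma path_trajectory_error:
  fixes x :: "nat \<Rightarrow> nat" and g :: "nat \<Rightarrow> real"
  assumes N: "0 < N" and x: "x 0 = 0" "\<And>n. x n \<le> N" "\<And>n. x n \<le> x (Suc n)"
    and lipschitz: "C-lipschitz_on {0..} \<gamma>"
    and approx: "\<And>k. k < N \<Longrightarrow> \<bar>g k - \<gamma> (real k / real N)\<bar> \<le> \<delta>"
    and g: "\<And>k. k < N \<Longrightarrow> 0 \<le> g k" "\<And>k. k < N \<Longrightarrow> g k \<le> G"
    and comp: "\<And>n. n \<le> nat \<lfloor>T * real N\<rfloor> \<Longrightarrow>
      \<bar>real (x n) - (\<Sum>i | i < n \<and> x i < N. 1 + g (x i))\<bar> \<le> m * real N"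
    and limit: "limit_trajectory \<gamma> Tstar z"
    and t: "t \<in> {0..T}"
  shows "\<bar>real (x (nat \<lfloor>t * real N\<rfloor>)) / real N - z t\<bar>
    \<le> (\<delta> * T + (1 + G) / real N + m) * exp (C * T)"
proof -
  have C: "0 \<le> C" using lipschitz by (rule lipschitz_on_nonneg)
  have \<delta>: "0 \<le> \<delta>" using approx[OF N] by linarith
  have G: "0 \<le> G" using g[OF N] by linarith
  have m: "0 \<le> m"
    using comp[of 0] x(1) N by (simp add: zero_le_mult_iff)
  have early: "\<bar>real (x (nat \<lfloor>s * real N\<rfloor>)) / real N - z s\<bar>
      \<le> (\<delta> * T + (1 + G) / real N + m) * exp (C * T)"
    if s: "0 \<le> s" "s \<le> T" "ereal s \<le> Tstar" for s
  proof -
    \<comment> \<open>The horizon is \<open>s\<close> and not \<open>T\<close>, because the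
      differential equation is available only up to \<open>Tstar\<close>. The resulting bound is
      then enlarged from \<open>s\<close> to \<open>T\<close>.\<close>
    interpret explored_path N g \<gamma> x z C \<delta> G m s
    proof
      show "\<bar>real (x n) - (\<Sum>i | i < n \<and> x i < N. 1 + g (x i))\<bar> \<le> m * real N"
        if "n \<le> nat \<lfloor>s * real N\<rfloor>" for n
      proof (rule comp)
        have "nat \<lfloor>s * real N\<rfloor> \<le> nat \<lfloor>T * real N\<rfloor>"
          using s by (intro nat_mono floor_mono mult_right_mono) auto
        then show "n \<le> nat \<lfloor>T * real N\<rfloor>" using that by simp
      qed
      have le: "ereal u \<le> Tstar" if "u \<le> s" for u
        using that s(3) order_trans[of "ereal u" "ereal s" Tstar] by simp
      show "z 0 = 0" using limit by (simp add: limit_trajectory_def)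
      show "continuous_on {0..s} z"
        using limit_trajectory_bounds(1)[OF limit] by (rule continuous_on_subset) (use le in auto)
      show "0 \<le> z u \<and> z u \<le> 1" if "u \<in> {0..s}" for u
        using limit_trajectory_bounds(2)[OF limit] le that by auto
      show "(z has_real_derivative 1 + \<gamma> (z u)) (at u)" if "0 < u" "u < s" for u
        using limit_trajectory_bounds(3)[OF limit that(1)] that(2) s(3)
        by (meson less_ereal.simps(1) less_le_trans)
    qed (use assms s in auto)
    have "\<bar>real (x (nat \<lfloor>s * real N\<rfloor>)) / real N - z s\<bar>
        \<le> (\<delta> * s + (1 + G) / real N + m) * exp (C * s)"
      using path_error[of s] s(1) by (simp add: step_at_def)
    also have "\<dots> \<le> (\<delta> * T + (1 + G) / real N + m) * exp (C * T)"
      using s C \<delta> G m by (intro mult_mono add_mono) (auto intro!: add_nonneg_nonneg mult_left_mono)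
    finally show ?thesis .
  qed
  show ?thesis
  proof (cases "ereal t \<le> Tstar")
    case True
    then show ?thesis using early[of t] t by simp
  next
    case False
    then have "Tstar \<noteq> \<infinity>" by auto
    then obtain s where s: "0 \<le> s" "Tstar = ereal s"
      using limit by (auto simp: limit_trajectory_def first_time_at_one_def)
    then have "s < t" using False by simp
    then have "nat \<lfloor>s * real N\<rfloor> \<le> nat \<lfloor>t * real N\<rfloor>"
      by (intro nat_mono floor_mono mult_right_mono) auto
    then have "x (nat \<lfloor>s * real N\<rfloor>) \<le> x (nat \<lfloor>t * real N\<rfloor>)"
      using lift_Suc_mono_le[of x] x(3) by auto
    then have "real (x (nat \<lfloor>s * real N\<rfloor>)) / real N \<le> real (x (nat \<lfloor>t * real N\<rfloor>)) / real N"
      by (intro divide_right_mono) auto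
    moreover have "real (x (nat \<lfloor>t * real N\<rfloor>)) / real N \<le> 1"
      using x(2) N by simp
    moreover have "z s = 1" "z t = 1"
      using limit_trajectory_after[OF limit] s \<open>s < t\<close> by auto
    ultimately show ?thesis
      using early[of s] s \<open>s < t\<close> t by auto
  qed
qed

section \<open>The martingale of the chain\<close>

context exploration_chain
begin

section \<open>The natural filtration and its atoms\<close>

lemma measurable_Z [measurable]: "Z n \<in> measurable P (count_space UNIV)"
  by (rule Z_measurable)

abbreviation history :: "nat \<Rightarrow> 'a measure" where
  "history \<equiv> natural_filtration P Z"

lemma space_history [simp]: "space (history n) = space P"
  by (simp add: natural_filtration_def space_measure_of_conv)

lemma sets_history:
  "sets (history n) = sigma_sets (space P) {Z i -` A \<inter> space P | i A. i \<le> n}"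
  unfolding natural_filtration_def by (rule sets_measure_of) auto

lemma subalgebra_history: "subalgebra P (history n)"
  unfolding subalgebra_def sets_history
  by (auto intro!: sets.sigma_sets_subset measurable_sets[OF Z_measurable])

lemma filtration_history: "filtration (space P) history"
proof
  show "sets (history i) \<subseteq> sets (history j)" if "i \<le> j" for i j
    unfolding sets_history using that by (intro sigma_sets_mono') (auto intro: order_trans)
qed simp

lemma Z_history: "i \<le> n \<Longrightarrow> Z i \<in> measurable (history n) (count_space UNIV)"
  by (rule measurableI) (auto simp: sets_history)

text \<open>The sets determined by the path up to step \<open>n\<close> are closed under complements
  and countable unions and contain the generators. As \<open>B\<close> is an arbitrary set of paths,
  no product sigma-algebra enters.\<close>

lemma history_setE:
  assumes "A \<in> sets (history n)"
  obtains B where "A = {\<omega> \<in> space P. restrict (\<lambda>i. Z i \<omega>) {..n} \<in> B}"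
proof -
  have "A \<in> sigma_sets (space P) {Z i -` A \<inter> space P | i A. i \<le> n}"
    using assms by (simp add: sets_history)
  then have "\<exists>B. A = {\<omega> \<in> space P. restrict (\<lambda>i. Z i \<omega>) {..n} \<in> B}"
  proof induction
    case (Basic A)
    then obtain i A' where "A = Z i -` A' \<inter> space P" "i \<le> n" by auto
    then show ?case by (intro exI[of _ "{xs. xs i \<in> A'}"]) auto
  next
    case Empty
    then show ?case by (intro exI[of _ "{}"]) auto
  next
    case (Compl A)
    then obtain B where "A = {\<omega> \<in> space P. restrict (\<lambda>i. Z i \<omega>) {..n} \<in> B}" by blast
    then show ?case by (intro exI[of _ "- B"]) blast
  next
    case (Union A)
    then obtain B where "\<And>i. A i = {\<omega> \<in> space P. restrict (\<lambda>i. Z i \<omega>) {..n} \<in> B i}" by metis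
    then show ?case by (intro exI[of _ "\<Union>i. B i"]) blast
  qed
  then show thesis by (elim exE) (rule that)
qed

definition atom :: "nat \<Rightarrow> (nat \<Rightarrow> nat) \<Rightarrow> 'a set" where
  "atom n xs = {\<omega> \<in> space P. \<forall>i\<le>n. Z i \<omega> = xs i}"

lemma atom_measurable [measurable]: "atom n xs \<in> sets P"
  unfolding atom_def by measurable

section \<open>Almost sure behaviour and conditional means of a step\<close>

lemma p_sum:
  assumes "x < N"
  shows "(\<Sum>k<N - x. pmf (p x) k) = 1"
  using sum_pmf_eq_1[of "{..<N - x}" "p x"] p_support[OF assms] by simp

text \<open>The product form of the transition law also covers states of probability zero, where
  both sides vanish.\<close>

lemma Z_transition_joint:
  assumes "x < N"
  shows "\<P>(\<omega> in P. Z (Suc n) \<omega> = x + k + 1 \<and> Z n \<omega> = x)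
    = pmf (p x) k * \<P>(\<omega> in P. Z n \<omega> = x)"
proof (cases "\<P>(\<omega> in P. Z n \<omega> = x) > 0")
  case True
  then show ?thesis
    using Z_transition[OF assms True, of k] by (simp add: cond_prob_def field_simps)
next
  case False
  then have "\<P>(\<omega> in P. Z n \<omega> = x) = 0"
    by (simp add: zero_less_measure_iff)
  moreover have "\<P>(\<omega> in P. Z (Suc n) \<omega> = x + k + 1 \<and> Z n \<omega> = x) \<le> \<P>(\<omega> in P. Z n \<omega> = x)"
    by (intro finite_measure_mono) auto
  ultimately show ?thesis by (simp add: measure_le_0_iff)
qed

text \<open>The transition probabilities over \<open>k < N - x\<close> sum to \<open>1\<close>, so
  these successors exhaust the event \<open>Z n = x\<close> up to a null set.\<close>

lemma AE_step_below:
  assumes x: "x < N"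
  shows "AE \<omega> in P. Z n \<omega> = x \<longrightarrow> (\<exists>k<N - x. Z (Suc n) \<omega> = x + k + 1)"
proof -
  let ?E = "\<lambda>k. {\<omega> \<in> space P. Z (Suc n) \<omega> = x + k + 1 \<and> Z n \<omega> = x}"
  let ?D = "{\<omega> \<in> space P. Z n \<omega> = x}"
  have "prob (\<Union>k<N - x. ?E k) = (\<Sum>k<N - x. prob (?E k))"
    by (intro finite_measure_finite_Union) (auto simp: disjoint_family_on_def)
  also have "\<dots> = prob ?D"
    using p_sum[OF x] by (simp only: Z_transition_joint[OF x] flip: sum_distrib_right)
  finally have "prob (?D - (\<Union>k<N - x. ?E k)) = 0"
    by (subst finite_measure_Diff) auto
  then have "AE \<omega> in P. \<omega> \<notin> ?D - (\<Union>k<N - x. ?E k)"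
    by (subst (asm) prob_eq_0) auto
  then show ?thesis using AE_space
    by eventually_elim blast
qed

lemma AE_absorbed: "AE \<omega> in P. Z n \<omega> = N \<longrightarrow> Z (Suc n) \<omega> = N"
proof (cases "\<P>(\<omega> in P. Z n \<omega> = N) > 0")
  case True
  let ?D = "{\<omega> \<in> space P. Z n \<omega> = N}"
  let ?E = "{\<omega> \<in> space P. Z (Suc n) \<omega> = N \<and> Z n \<omega> = N}"
  have "prob ?E = prob ?D"
    using Z_absorbed[OF True] True by (simp add: cond_prob_def field_simps)
  then have "prob (?D - ?E) = 0"
    by (subst finite_measure_Diff) auto
  then have "AE \<omega> in P. \<omega> \<notin> ?D - ?E"
    by (subst (asm) prob_eq_0) auto
  then show ?thesis using AE_space
    by eventually_elim auto
next
  case False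
  then have "prob {\<omega> \<in> space P. Z n \<omega> = N} = 0"
    by (simp add: zero_less_measure_iff)
  then have "AE \<omega> in P. \<omega> \<notin> {\<omega> \<in> space P. Z n \<omega> = N}"
    by (subst (asm) prob_eq_0) auto
  then show ?thesis using AE_space
    by eventually_elim auto
qed

lemma AE_step:
  "AE \<omega> in P. (\<forall>x<N. Z n \<omega> = x \<longrightarrow> (\<exists>k<N - x. Z (Suc n) \<omega> = x + k + 1)) \<and>
    (Z n \<omega> = N \<longrightarrow> Z (Suc n) \<omega> = N)"
proof -
  have "AE \<omega> in P. \<forall>x\<in>{..<N}. Z n \<omega> = x \<longrightarrow> (\<exists>k<N - x. Z (Suc n) \<omega> = x + k + 1)"
    using AE_step_below by (intro AE_finite_allI) auto
  then show ?thesis using AE_absorbed[of n]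
    by eventually_elim auto
qed

lemma AE_path: "AE \<omega> in P. Z 0 \<omega> = 0 \<and> (\<forall>n. Z n \<omega> \<le> N \<and> Z n \<omega> \<le> Z (Suc n) \<omega>)"
proof -
  have "AE \<omega> in P. \<forall>n. (\<forall>x<N. Z n \<omega> = x \<longrightarrow> (\<exists>k<N - x. Z (Suc n) \<omega> = x + k + 1)) \<and>
    (Z n \<omega> = N \<longrightarrow> Z (Suc n) \<omega> = N)"
    using AE_step by (simp add: AE_all_countable)
  then show ?thesis using Z_start
  proof eventually_elim
    case (elim \<omega>)
    have step: "Z n \<omega> \<le> Z (Suc n) \<omega> \<and> Z (Suc n) \<omega> \<le> N" if "Z n \<omega> \<le> N" for n
    proof (cases "Z n \<omega> < N")
      case True
      then obtain k where "k < N - Z n \<omega>" "Z (Suc n) \<omega> = Z n \<omega> + k + 1"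
        using elim(1) by blast
      then show ?thesis by simp
    next
      case False
      then show ?thesis using elim(1) that by simp
    qed
    have "Z n \<omega> \<le> N" for n
      by (induction n) (use elim(2) step in auto)
    then show ?case using elim(2) step by simp
  qed
qed

text \<open>The Markov property reduces conditioning on the history to conditioning on the current
  state. Null atoms are again covered by the product form.\<close>

lemma atom_transition:
  assumes "xs n < N"
  shows "prob {\<omega> \<in> space P. Z (Suc n) \<omega> = xs n + k + 1 \<and> (\<forall>i\<le>n. Z i \<omega> = xs i)}
    = pmf (p (xs n)) k * prob (atom n xs)"
proof (cases "prob (atom n xs) > 0")
  case True
  then have pos: "\<P>(\<omega> in P. \<forall>i\<le>n. Z i \<omega> = xs i) > 0"
    by (simp add: atom_def)
  also have "\<P>(\<omega> in P. \<forall>i\<le>n. Z i \<omega> = xs i) \<le> \<P>(\<omega> in P. Z n \<omega> = xs n)"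
    by (intro finite_measure_mono) auto
  finally have "\<P>(\<omega> in P. Z (Suc n) \<omega> = xs n + k + 1 \<bar> Z n \<omega> = xs n) = pmf (p (xs n)) k"
    by (rule Z_transition[OF assms])
  with Z_Markov[OF pos, of "xs n + k + 1"]
  have "\<P>(\<omega> in P. Z (Suc n) \<omega> = xs n + k + 1 \<bar> \<forall>i\<le>n. Z i \<omega> = xs i) = pmf (p (xs n)) k"
    by simp
  then show ?thesis
    using pos by (simp add: cond_prob_def atom_def field_simps)
next
  case False
  then have "prob (atom n xs) = 0"
    by (simp add: zero_less_measure_iff)
  moreover have "prob {\<omega> \<in> space P. Z (Suc n) \<omega> = xs n + k + 1 \<and> (\<forall>i\<le>n. Z i \<omega> = xs i)}
      \<le> prob (atom n xs)"
    unfolding atom_def by (intro finite_measure_mono) auto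
  ultimately show ?thesis by (simp add: measure_le_0_iff)
qed

text \<open>The conditional mean of \<open>g (Z n) (Z (Suc n))\<close> given \<open>Z n = x\<close>.
  The second branch expresses absorption at \<open>N\<close>.\<close>

definition kernel_mean :: "(nat \<Rightarrow> nat \<Rightarrow> real) \<Rightarrow> nat \<Rightarrow> real" where
  "kernel_mean g x = (if x < N then \<Sum>k<N - x. pmf (p x) k * g x (x + k + 1) else g x x)"

text \<open>On an atom the next state takes finitely many values almost surely, so the integrand
  agrees almost everywhere with a finite combination of indicators of events of known
  probability.\<close>

lemma atom_mean:
  fixes g :: "nat \<Rightarrow> nat \<Rightarrow> real"
  assumes "xs n \<le> N"
  shows "integrable P (\<lambda>\<omega>. indicator (atom n xs) \<omega> * g (Z n \<omega>) (Z (Suc n) \<omega>))" (is ?int)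
    and "(\<integral>\<omega>. indicator (atom n xs) \<omega> * g (Z n \<omega>) (Z (Suc n) \<omega>) \<partial>P)
      = prob (atom n xs) * kernel_mean g (xs n)" (is ?eq)
proof -
  let ?f = "\<lambda>\<omega>. indicator (atom n xs) \<omega> * g (Z n \<omega>) (Z (Suc n) \<omega>)"
  have "?int \<and> ?eq"
  proof (cases "xs n < N")
    case True
    let ?E = "\<lambda>k. {\<omega> \<in> space P. Z (Suc n) \<omega> = xs n + k + 1 \<and> (\<forall>i\<le>n. Z i \<omega> = xs i)}"
    let ?h = "\<lambda>\<omega>. \<Sum>k<N - xs n. g (xs n) (xs n + k + 1) * indicator (?E k) \<omega>"
    have E [measurable]: "?E k \<in> sets P" for k by measurable
    have "AE \<omega> in P. ?f \<omega> = ?h \<omega>"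
      using AE_step[of n]
    proof eventually_elim
      case (elim \<omega>)
      show ?case
      proof (cases "\<omega> \<in> atom n xs")
        case in_atom: True
        then obtain k where k: "k < N - xs n" "Z (Suc n) \<omega> = xs n + k + 1"
          using elim True by (auto simp: atom_def)
        have "?h \<omega> = (\<Sum>j<N - xs n. if j = k then g (xs n) (xs n + k + 1) else 0)"
          using in_atom k by (intro sum.cong) (auto simp: atom_def indicator_def)
        then show ?thesis
          using in_atom k by (simp add: atom_def)
      next
        case False
        then show ?thesis by (auto simp: atom_def indicator_def intro!: sum.neutral)
      qed
    qed
    moreover have "integrable P ?h"
      by (intro Bochner_Integration.integrable_sum integrable_mult_right
          integrable_real_indicator E) (simp add: emeasure_eq_measure)
    moreover have "(\<integral>\<omega>. ?h \<omega> \<partial>P) = prob (atom n xs) * kernel_mean g (xs n)"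
    proof -
      have "(\<integral>\<omega>. ?h \<omega> \<partial>P) = (\<Sum>k<N - xs n. g (xs n) (xs n + k + 1) * prob (?E k))"
        by (subst Bochner_Integration.integral_sum)
          (auto intro!: integrable_real_indicator simp: emeasure_eq_measure)
      then show ?thesis
        using True atom_transition[of xs n]
        by (simp add: kernel_mean_def sum_distrib_left mult_ac)
    qed
    ultimately show ?thesis
      using integrable_cong_AE[of ?f P ?h] integral_cong_AE[of ?f P ?h] by auto
  next
    case False
    then have xs: "xs n = N" using assms by simp
    have "AE \<omega> in P. ?f \<omega> = g N N * indicator (atom n xs) \<omega>"
      using AE_absorbed[of n] by eventually_elim (auto simp: indicator_def atom_def xs)
    moreover have "integrable P (\<lambda>\<omega>. g N N * indicator (atom n xs) \<omega>)"
      by (intro integrable_mult_right integrable_real_indicator) (auto simp: emeasure_eq_measure)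
    ultimately show ?thesis
      using integrable_cong_AE[of ?f P "\<lambda>\<omega>. g N N * indicator (atom n xs) \<omega>"]
        integral_cong_AE[of ?f P "\<lambda>\<omega>. g N N * indicator (atom n xs) \<omega>"]
      by (auto simp: kernel_mean_def xs)
  qed
  then show ?int ?eq by auto
qed

text \<open>Almost every outcome lies in exactly one atom with \<open>xs\<close> in the finite set
  of extensional paths with values up to \<open>N\<close>.\<close>

lemma indicator_history_decomp:
  fixes f :: "'a \<Rightarrow> real"
  assumes A: "A = {\<omega> \<in> space P. restrict (\<lambda>i. Z i \<omega>) {..n} \<in> B}"
  shows "AE \<omega> in P. indicator A \<omega> * f \<omega>
    = (\<Sum>xs\<in>{..n} \<rightarrow>\<^sub>E {..N}. indicator B xs * (indicator (atom n xs) \<omega> * f \<omega>))"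
  using AE_path AE_space
proof eventually_elim
  case (elim \<omega>)
  let ?x = "restrict (\<lambda>i. Z i \<omega>) {..n}"
  have x: "?x \<in> {..n} \<rightarrow>\<^sub>E {..N}"
    using elim(1) by auto
  have "\<omega> \<in> atom n xs \<longleftrightarrow> xs = ?x" if "xs \<in> {..n} \<rightarrow>\<^sub>E {..N}" for xs
    using that elim(2) by (auto simp: atom_def PiE_iff extensional_def fun_eq_iff)
  then have "(\<Sum>xs\<in>{..n} \<rightarrow>\<^sub>E {..N}. indicator B xs * (indicator (atom n xs) \<omega> * f \<omega>))
    = (\<Sum>xs\<in>{..n} \<rightarrow>\<^sub>E {..N}. if xs = ?x then indicator B xs * f \<omega> else 0)"
    by (intro sum.cong) (auto simp: indicator_def)
  also have "\<dots> = indicator B ?x * f \<omega>"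
    using x by (simp add: finite_PiE)
  finally show ?case
    using elim(2) by (simp add: A indicator_def)
qed

text \<open>The Markov property in integrated form: given the history, the mean of
  \<open>g (Z n) (Z (Suc n))\<close> is \<open>kernel_mean g (Z n)\<close>, tested on the sets of
  the filtration.\<close>

lemma history_mean:
  fixes g :: "nat \<Rightarrow> nat \<Rightarrow> real"
  assumes "A \<in> sets (history n)"
  shows "integrable P (\<lambda>\<omega>. indicator A \<omega> * g (Z n \<omega>) (Z (Suc n) \<omega>))"
    and "(\<integral>\<omega>. indicator A \<omega> * g (Z n \<omega>) (Z (Suc n) \<omega>) \<partial>P)
      = (\<integral>\<omega>. indicator A \<omega> * kernel_mean g (Z n \<omega>) \<partial>P)"
proof -
  obtain B where A: "A = {\<omega> \<in> space P. restrict (\<lambda>i. Z i \<omega>) {..n} \<in> B}"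
    using assms by (rule history_setE)
  have [measurable]: "A \<in> sets P"
    using assms subalgebra_history by (auto simp: subalgebra_def)
  let ?S = "{..n} \<rightarrow>\<^sub>E {..N}"
  let ?h = "\<lambda>f \<omega>. \<Sum>xs\<in>?S. indicator B xs * (indicator (atom n xs) \<omega> * f \<omega>)"
  let ?f = "\<lambda>\<omega>. g (Z n \<omega>) (Z (Suc n) \<omega>)" and ?f' = "\<lambda>\<omega>. kernel_mean g (Z n \<omega>)"
  have le: "xs n \<le> N" if "xs \<in> ?S" for xs using that by auto
  \<comment> \<open>The two sides are compared atom by atom: on an atom \<open>Z n\<close> equals
    \<open>xs n\<close>, so the kernel mean is constant there.\<close>
  have const: "(\<lambda>\<omega>. indicator (atom n xs) \<omega> * ?f' \<omega>)
      = (\<lambda>\<omega>. indicator (atom n xs) \<omega> * kernel_mean g (xs n))" for xs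
    by (auto simp: fun_eq_iff indicator_def atom_def)
  have atom': "integrable P (\<lambda>\<omega>. indicator (atom n xs) \<omega> * ?f' \<omega>)"
    "(\<integral>\<omega>. indicator (atom n xs) \<omega> * ?f' \<omega> \<partial>P) = prob (atom n xs) * kernel_mean g (xs n)" for xs
    unfolding const by (auto intro!: integrable_real_indicator simp: emeasure_eq_measure)
  have int: "integrable P (?h ?f)" "integrable P (?h ?f')"
    using atom' by (auto intro!: Bochner_Integration.integrable_sum integrable_mult_right
        atom_mean(1) le)
  have eq: "(\<integral>\<omega>. ?h ?f \<omega> \<partial>P) = (\<integral>\<omega>. ?h ?f' \<omega> \<partial>P)"
    using atom' by (subst (1 2) Bochner_Integration.integral_sum)
      (auto intro!: sum.cong integrable_mult_right atom_mean(1) le simp: atom_mean(2) le)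
  note AE = indicator_history_decomp[OF A, of ?f] indicator_history_decomp[OF A, of ?f']
  show "integrable P (\<lambda>\<omega>. indicator A \<omega> * ?f \<omega>)"
    using AE(1) int(1) by (subst integrable_cong_AE) auto
  have "(\<integral>\<omega>. indicator A \<omega> * ?f \<omega> \<partial>P) = (\<integral>\<omega>. ?h ?f \<omega> \<partial>P)"
    using AE(1) by (intro integral_cong_AE) auto
  moreover have "(\<integral>\<omega>. indicator A \<omega> * ?f' \<omega> \<partial>P) = (\<integral>\<omega>. ?h ?f' \<omega> \<partial>P)"
    using AE(2) by (intro integral_cong_AE) auto
  ultimately show "(\<integral>\<omega>. indicator A \<omega> * ?f \<omega> \<partial>P) = (\<integral>\<omega>. indicator A \<omega> * ?f' \<omega> \<partial>P)"
    using eq by simp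
qed

section \<open>Conditional mean and variance of an increment\<close>

lemma gammaN_nonneg: "0 \<le> gammaN N p x"
  by (auto simp: gammaN_def intro!: sum_nonneg)

lemma psiN_nonneg: "0 \<le> psiN N p x"
  by (auto simp: psiN_def intro!: sum_nonneg)

lemma gammaN_le_bar: "x < N \<Longrightarrow> gammaN N p x \<le> gammaN_bar N p"
  unfolding gammaN_bar_def by (intro cSUP_upper) auto

lemma psiN_le_bar: "x < N \<Longrightarrow> psiN N p x \<le> psiN_bar N p"
  unfolding psiN_bar_def by (intro cSUP_upper) auto

lemma gammaN_bar_nonneg: "0 \<le> gammaN_bar N p"
  using gammaN_nonneg gammaN_le_bar[OF N_pos] order_trans by blast

lemma psiN_bar_nonneg: "0 \<le> psiN_bar N p"
  using psiN_nonneg psiN_le_bar[OF N_pos] order_trans by blast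

text \<open>The increment of the compensated process caused by a step from \<open>x\<close> to
  \<open>y\<close>.\<close>

definition innovation :: "nat \<Rightarrow> nat \<Rightarrow> real" where
  "innovation x y = real y - real x - (if x < N then 1 + gammaN N p x else 0)"

lemma sum_p_support:
  fixes f :: "nat \<Rightarrow> real"
  assumes "x < N"
  shows "(\<Sum>k<N - x. f k * pmf (p x) k) = (\<Sum>k = 0..N - 1. f k * pmf (p x) k)"
proof (rule sum.mono_neutral_left)
  show "\<forall>k\<in>{0..N - 1} - {..<N - x}. f k * pmf (p x) k = 0"
    using p_support[OF assms] by (auto simp: pmf_eq_0_set_pmf)
qed auto

lemma kernel_mean_innovation: "kernel_mean innovation x = 0"
proof (cases "x < N")
  case True
  have "kernel_mean innovation x = (\<Sum>k<N - x. real k * pmf (p x) k - gammaN N p x * pmf (p x) k)"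
    using True by (simp add: kernel_mean_def innovation_def algebra_simps)
  also have "\<dots> = gammaN N p x - gammaN N p x * (\<Sum>k<N - x. pmf (p x) k)"
    using sum_p_support[OF True, of real]
    by (simp add: sum_subtractf sum_distrib_left gammaN_def)
  finally show ?thesis
    using p_sum[OF True] by simp
qed (simp add: kernel_mean_def innovation_def)

lemma kernel_mean_innovation_squared:
  "kernel_mean (\<lambda>x y. (innovation x y)\<^sup>2) x = (if x < N then psiN N p x else 0)"
proof (cases "x < N")
  case True
  have "kernel_mean (\<lambda>x y. (innovation x y)\<^sup>2) x
      = (\<Sum>k<N - x. (real k - gammaN N p x)\<^sup>2 * pmf (p x) k)"
    using True by (simp add: kernel_mean_def innovation_def algebra_simps)
  then show ?thesis
    using sum_p_support[OF True, of "\<lambda>k. (real k - gammaN N p x)\<^sup>2"] True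
    by (simp add: psiN_def)
qed (simp add: kernel_mean_def innovation_def)

section \<open>The compensated process as a martingale\<close>

abbreviation comp :: "nat \<Rightarrow> 'a \<Rightarrow> real" where
  "comp \<equiv> comp_process N p Z"

lemma comp_eq:
  "comp n \<omega> = real (Z n \<omega>) - (\<Sum>i<n. if Z i \<omega> < N then 1 + gammaN N p (Z i \<omega>) else 0)"
proof -
  have "{i. i < n \<and> Z i \<omega> < N} = {i \<in> {..<n}. Z i \<omega> < N}" by auto
  then show ?thesis
    by (simp only: comp_process_def sum.inter_filter[OF finite_lessThan])
qed

lemma comp_Suc: "comp (Suc n) \<omega> = comp n \<omega> + innovation (Z n \<omega>) (Z (Suc n) \<omega>)"
  by (simp add: comp_eq innovation_def)

lemma comp_history: "comp n \<in> borel_measurable (history n)"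
proof -
  have meas: "(\<lambda>\<omega>. f (Z i \<omega>)) \<in> borel_measurable (history n)" if "i \<le> n"
    for i and f :: "nat \<Rightarrow> real"
    by (rule measurable_compose[OF Z_history[OF that]]) simp
  show ?thesis
    unfolding comp_eq
    by (intro borel_measurable_diff borel_measurable_sum meas
        meas[of _ "\<lambda>x. if x < N then 1 + gammaN N p x else 0"]) auto
qed

lemma comp_measurable [measurable]: "comp n \<in> borel_measurable P"
  using measurable_from_subalg[OF subalgebra_history comp_history] .

text \<open>A crude almost sure bound that serves for integrability and as the bound in Doob's
  inequality; it does not enter the final estimate.\<close>

lemma AE_comp_le: "AE \<omega> in P. \<bar>comp n \<omega>\<bar> \<le> real N + real n * (1 + gammaN_bar N p)"
  using AE_path
proof eventually_elim
  case (elim \<omega>)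
  let ?c = "\<lambda>i. if Z i \<omega> < N then 1 + gammaN N p (Z i \<omega>) else 0"
  have "(\<Sum>i<n. ?c i) \<le> of_nat (card {..<n}) * (1 + gammaN_bar N p)"
    using gammaN_le_bar gammaN_bar_nonneg by (intro sum_bounded_above) auto
  moreover have "0 \<le> (\<Sum>i<n. ?c i)"
    using gammaN_nonneg by (intro sum_nonneg) (auto intro: add_nonneg_nonneg)
  moreover have "real (Z n \<omega>) \<le> real N"
    using elim by simp
  ultimately show ?case
    unfolding comp_eq by auto
qed

lemma integrable_comp: "integrable P (comp n)"
  using AE_comp_le by (intro integrable_AE_bounded) auto

text \<open>The conditional expectation is identified by testing on sets of the history, where the
  innovation has mean zero since its kernel mean vanishes in every state.\<close>

theorem martingale_comp: "is_martingale P history comp"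
  unfolding is_martingale_def
proof (intro conjI allI filtration_history subalgebra_history comp_history integrable_comp)
  fix n
  interpret finite_measure_subalgebra P "history n"
    using subalgebra_history by unfold_locales
  show "AE \<omega> in P. real_cond_exp P (history n) (comp (Suc n)) \<omega> = comp n \<omega>"
  proof (rule real_cond_exp_charact[OF _ integrable_comp integrable_comp comp_history])
    fix A assume A: "A \<in> sets (history n)"
    then have [measurable]: "A \<in> sets P"
      using subalg by (auto simp: subalgebra_def)
    have "integrable P (\<lambda>\<omega>. indicator A \<omega> * comp n \<omega>)"
      using integrable_mult_indicator[OF \<open>A \<in> sets P\<close> integrable_comp[of n]] by simp
    moreover have "(\<integral>\<omega>. indicator A \<omega> * innovation (Z n \<omega>) (Z (Suc n) \<omega>) \<partial>P) = 0"
      using history_mean(2)[OF A, of innovation] by (simp add: kernel_mean_innovation)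
    ultimately show "(\<integral>\<omega>\<in>A. comp (Suc n) \<omega> \<partial>P) = (\<integral>\<omega>\<in>A. comp n \<omega> \<partial>P)"
      using history_mean(1)[OF A, of innovation]
      by (simp add: set_lebesgue_integral_def comp_Suc distrib_left)
  qed
qed

lemma integrable_comp_squared: "integrable P (\<lambda>\<omega>. (comp n \<omega>)\<^sup>2)"
proof (rule integrable_AE_bounded)
  show "AE \<omega> in P. \<bar>(comp n \<omega>)\<^sup>2\<bar> \<le> (real N + real n * (1 + gammaN_bar N p))\<^sup>2"
    using AE_comp_le[of n] by eventually_elim (auto intro: power2_le_iff_abs_le[THEN iffD2])
qed measurable

text \<open>The cross term vanishes by orthogonality, so each step adds the mean of the squared
  innovation. Its kernel mean is \<open>psiN\<close> in a live state and \<open>0\<close> after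
  absorption.\<close>

lemma comp_second_moment: "(\<integral>\<omega>. (comp n \<omega>)\<^sup>2 \<partial>P) \<le> real n * psiN_bar N p"
proof (induction n)
  case 0
  have "(\<integral>\<omega>. (comp 0 \<omega>)\<^sup>2 \<partial>P) = (\<integral>\<omega>. 0 \<partial>P)"
    using Z_start by (intro integral_cong_AE) (auto simp: comp_eq)
  then show ?case by simp
next
  case (Suc n)
  let ?d = "\<lambda>\<omega>. innovation (Z n \<omega>) (Z (Suc n) \<omega>)"
  \<comment> \<open>Taking the whole space as the test set turns \<open>history_mean\<close> into a
    statement on plain expectations.\<close>
  have space: "space P \<in> sets (history n)"
    using sets.top[of "history n"] by simp
  have d2: "integrable P (\<lambda>\<omega>. (?d \<omega>)\<^sup>2)"
    "(\<integral>\<omega>. (?d \<omega>)\<^sup>2 \<partial>P) = (\<integral>\<omega>. (if Z n \<omega> < N then psiN N p (Z n \<omega>) else 0) \<partial>P)"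
    using history_mean[OF space, of "\<lambda>x y. (innovation x y)\<^sup>2"]
    by (simp_all add: kernel_mean_innovation_squared
        cong: Bochner_Integration.integrable_cong Bochner_Integration.integral_cong)
  have "(\<integral>\<omega>. (if Z n \<omega> < N then psiN N p (Z n \<omega>) else 0) \<partial>P) \<le> (\<integral>\<omega>. psiN_bar N p \<partial>P)"
    using psiN_le_bar psiN_bar_nonneg by (intro integral_mono_AE') auto
  then have d2_le: "(\<integral>\<omega>. (?d \<omega>)\<^sup>2 \<partial>P) \<le> psiN_bar N p"
    using d2 by (simp add: prob_space)
  have orth: "integrable P (\<lambda>\<omega>. comp n \<omega> * ?d \<omega>)" "(\<integral>\<omega>. comp n \<omega> * ?d \<omega> \<partial>P) = 0"
    using martingale_orthogonal[OF martingale_comp comp_history AE_comp_le, of n]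
    by (simp_all add: comp_Suc)
  have "(\<integral>\<omega>. (comp (Suc n) \<omega>)\<^sup>2 \<partial>P)
      = (\<integral>\<omega>. (comp n \<omega>)\<^sup>2 + 2 * (comp n \<omega> * ?d \<omega>) + (?d \<omega>)\<^sup>2 \<partial>P)"
    by (simp add: comp_Suc power2_sum algebra_simps)
  also have "\<dots> = (\<integral>\<omega>. (comp n \<omega>)\<^sup>2 \<partial>P) + (\<integral>\<omega>. (?d \<omega>)\<^sup>2 \<partial>P)"
    using orth d2(1) integrable_comp_squared by simp
  finally show ?case
    using Suc d2_le by (simp add: algebra_simps)
qed

section \<open>From the pathwise bound to the norm estimates\<close>

lemma comp_path_error:
  assumes lipschitz: "C-lipschitz_on {0..} \<gamma>"
    and approx: "\<And>k. k < N \<Longrightarrow> \<bar>gammaN N p k - \<gamma> (real k / real N)\<bar> \<le> \<delta>"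
    and limit: "limit_trajectory \<gamma> Tstar z"
    and T: "0 < T"
  shows "AE \<omega> in P. \<bar>SUP s\<in>{0..T}. \<bar>scaled_process N Z s \<omega> - z s\<bar>\<bar>
    \<le> exp (C * T) * (\<delta> * T + (1 + gammaN_bar N p) / real N
        + 1 / real N * running_max (\<lambda>i. \<bar>comp i \<omega>\<bar>) (nat \<lfloor>T * real N\<rfloor>))"
  using AE_path
proof eventually_elim
  case (elim \<omega>)
  \<comment> \<open>The bound \<open>m\<close> of the deterministic analysis becomes random: it is
    the running maximum of the martingale, scaled by \<open>N\<close>.\<close>
  let ?m = "1 / real N * running_max (\<lambda>i. \<bar>comp i \<omega>\<bar>) (nat \<lfloor>T * real N\<rfloor>)"
  let ?f = "\<lambda>s. \<bar>scaled_process N Z s \<omega> - z s\<bar>"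
  let ?c = "(\<delta> * T + (1 + gammaN_bar N p) / real N + ?m) * exp (C * T)"
  have le: "?f s \<le> ?c" if "s \<in> {0..T}" for s
    unfolding scaled_process_def
  proof (rule path_trajectory_error[OF N_pos _ _ _ lipschitz approx gammaN_nonneg gammaN_le_bar _ limit that,
        of "\<lambda>n. Z n \<omega>"])
    fix n
    assume "n \<le> nat \<lfloor>T * real N\<rfloor>"
    then have "\<bar>comp n \<omega>\<bar> \<le> ?m * real N"
      using N_pos running_max_ge[of n "nat \<lfloor>T * real N\<rfloor>" "\<lambda>i. \<bar>comp i \<omega>\<bar>"] by simp
    then show "\<bar>real (Z n \<omega>) - (\<Sum>i | i < n \<and> Z i \<omega> < N. 1 + gammaN N p (Z i \<omega>))\<bar> \<le> ?m * real N"
      by (simp add: comp_process_def)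
  qed (use elim in auto)
  have "(SUP s\<in>{0..T}. ?f s) \<le> ?c"
    using T le by (intro cSUP_least) auto
  \<comment> \<open>Boundedness from \<open>le\<close> is used here as well: it makes the supremum
    dominate the value at time \<open>0\<close>.\<close>
  moreover have "0 \<le> (SUP s\<in>{0..T}. ?f s)"
    using T le by (intro cSUP_upper2[of ?f _ 0] bdd_aboveI2[of _ ?f ?c] le) auto
  ultimately show ?case by (simp add: mult.commute)
qed

lemma Lp_error_bound:
  fixes q :: real
  assumes lipschitz: "C-lipschitz_on {0..} \<gamma>"
    and approx: "\<And>k. k < N \<Longrightarrow> \<bar>gammaN N p k - \<gamma> (real k / real N)\<bar> \<le> \<delta>"
    and limit: "limit_trajectory \<gamma> Tstar z"
    and T: "0 < T" and q: "1 < q"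
  shows "Lp_norm P q (\<lambda>\<omega>. SUP s\<in>{0..T}. \<bar>scaled_process N Z s \<omega> - z s\<bar>)
    \<le> (\<delta> * T + (1 + gammaN_bar N p) / real N
        + q / (q - 1) * Lp_norm P q (\<lambda>\<omega>. comp (nat \<lfloor>T * real N\<rfloor>) \<omega> / real N)) * exp (C * T)"
proof -
  define n where "n = nat \<lfloor>T * real N\<rfloor>"
  define a where "a = \<delta> * T + (1 + gammaN_bar N p) / real N"
  let ?r = "\<lambda>\<omega>. running_max (\<lambda>i. \<bar>comp i \<omega>\<bar>) n"
  let ?f = "\<lambda>\<omega>. 1 / real N * ?r \<omega>"
  define K where "K = real N + real n * (1 + gammaN_bar N p)"
  have \<delta>: "0 \<le> \<delta>" using approx[OF N_pos] by linarith
  have "0 \<le> \<delta> * T" using \<delta> T by simp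
  moreover have "0 < (1 + gammaN_bar N p) / real N"
    using gammaN_bar_nonneg N_pos by simp
  \<comment> \<open>\<open>Lp_norm_const_add_le\<close> asks for a strictly positive constant. The
    second summand provides it even for \<open>\<delta> = 0\<close>.\<close>
  ultimately have a: "0 < a" unfolding a_def by linarith
  have f: "0 \<le> ?f \<omega>" for \<omega>
    using running_max_nonneg[of "\<lambda>i. \<bar>comp i \<omega>\<bar>" n] by simp
  have comp_le: "AE \<omega> in P. \<bar>comp i \<omega>\<bar> \<le> K" if "i \<le> n" for i
    using AE_comp_le[of i]
  proof eventually_elim
    case (elim \<omega>)
    have "real i * (1 + gammaN_bar N p) \<le> real n * (1 + gammaN_bar N p)"
      using that gammaN_bar_nonneg by (intro mult_right_mono) auto
    then show ?case using elim by (simp add: K_def)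
  qed
  have "AE \<omega> in P. \<forall>i\<in>{..n}. \<bar>comp i \<omega>\<bar> \<le> K"
    using comp_le by (intro AE_finite_allI) auto
  then have "AE \<omega> in P. ?r \<omega> \<le> K"
    by eventually_elim (auto intro: running_max_le)
  then have f_le: "AE \<omega> in P. ?f \<omega> \<le> K / real N"
    by eventually_elim (auto intro: divide_right_mono)
  have [measurable]: "(\<lambda>\<omega>. running_max (\<lambda>i. \<bar>comp i \<omega>\<bar>) k) \<in> borel_measurable P" for k
    by (induction k) (simp_all add: running_max_Suc)
  have "Lp_norm P q (\<lambda>\<omega>. SUP s\<in>{0..T}. \<bar>scaled_process N Z s \<omega> - z s\<bar>)
      \<le> Lp_norm P q (\<lambda>\<omega>. exp (C * T) * (a + ?f \<omega>))"
  proof (rule Lp_norm_mono)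
    show "AE \<omega> in P. \<bar>SUP s\<in>{0..T}. \<bar>scaled_process N Z s \<omega> - z s\<bar>\<bar>
        \<le> exp (C * T) * (a + ?f \<omega>)"
      using comp_path_error[OF lipschitz approx limit T] by (simp add: a_def n_def)
    show "integrable P (\<lambda>\<omega>. \<bar>exp (C * T) * (a + ?f \<omega>)\<bar> powr q)"
    proof (rule integrable_AE_bounded)
      show "AE \<omega> in P. \<bar>\<bar>exp (C * T) * (a + ?f \<omega>)\<bar> powr q\<bar> \<le> (exp (C * T) * (a + K / real N)) powr q"
        using f_le
      proof eventually_elim
        case (elim \<omega>)
        have "\<bar>exp (C * T) * (a + ?f \<omega>)\<bar> = exp (C * T) * (a + ?f \<omega>)"
          using a f[of \<omega>] by simp
        also have "\<dots> \<le> exp (C * T) * (a + K / real N)"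
          using elim by (intro mult_left_mono add_left_mono) auto
        finally show ?case
          using q by (simp add: powr_mono2)
      qed
    qed measurable
  qed (use q in simp)
  also have "\<dots> = exp (C * T) * Lp_norm P q (\<lambda>\<omega>. a + ?f \<omega>)"
    using q by (intro Lp_norm_mult) auto
  also have "\<dots> \<le> exp (C * T) * (a + Lp_norm P q ?f)"
    using Lp_norm_const_add_le[OF q a f _ f_le] by (intro mult_left_mono) auto
  also have "Lp_norm P q ?f = 1 / real N * Lp_norm P q ?r"
    using q by (intro Lp_norm_mult) auto
  also have "exp (C * T) * (a + 1 / real N * Lp_norm P q ?r)
      \<le> exp (C * T) * (a + 1 / real N * (q / (q - 1) * Lp_norm P q (comp n)))"
    using doob_Lp[OF martingale_comp q comp_le]
    by (intro mult_left_mono add_left_mono) auto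
  also have "1 / real N * (q / (q - 1) * Lp_norm P q (comp n))
      = q / (q - 1) * Lp_norm P q (\<lambda>\<omega>. 1 / real N * comp n \<omega>)"
    using q by (subst Lp_norm_mult) auto
  finally show ?thesis
    by (simp add: a_def n_def mult.commute)
qed

text \<open>There are at most \<open>T * N\<close> steps, each adding at most
  \<open>psiN_bar\<close> to the second moment, and the scaling divides by the square of
  \<open>N\<close>.\<close>

lemma L2_comp_le:
  assumes T: "0 < T"
  shows "Lp_norm P 2 (\<lambda>\<omega>. comp (nat \<lfloor>T * real N\<rfloor>) \<omega> / real N) \<le> sqrt (psiN_bar N p * T / real N)"
proof -
  let ?n = "nat \<lfloor>T * real N\<rfloor>"
  have "(\<integral>\<omega>. \<bar>comp ?n \<omega> / real N\<bar> powr 2 \<partial>P) = (\<integral>\<omega>. (comp ?n \<omega>)\<^sup>2 \<partial>P) / (real N)\<^sup>2"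
    by (simp add: power_divide)
  also have "\<dots> \<le> (T * real N) * psiN_bar N p / (real N)\<^sup>2"
  proof (rule divide_right_mono)
    have "real ?n \<le> T * real N"
      using T by (simp add: of_nat_nat)
    then have "real ?n * psiN_bar N p \<le> (T * real N) * psiN_bar N p"
      using psiN_bar_nonneg by (rule mult_right_mono)
    then show "(\<integral>\<omega>. (comp ?n \<omega>)\<^sup>2 \<partial>P) \<le> (T * real N) * psiN_bar N p"
      using comp_second_moment[of ?n] by linarith
  qed simp
  also have "\<dots> = psiN_bar N p * T / real N"
    by (simp add: power2_eq_square)
  finally show ?thesis
    by (simp add: Lp_norm_def powr_half_sqrt)
qed

end

theorem proposition2p2:
  fixes P :: "'a measure" and N :: nat and pN :: "nat \<Rightarrow> nat pmf" and Z :: "nat \<Rightarrow> 'a \<Rightarrow> nat"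
    and \<gamma> :: "real \<Rightarrow> real" and C\<^sub>L \<delta> :: real
    and z :: "real \<Rightarrow> real" and Tstar :: ereal
  assumes chain: "exploration_chain P N pN Z"
    and lipschitz: "C\<^sub>L-lipschitz_on {0..} \<gamma>"
    and approx: "(SUP x\<in>{..<N}. \<bar>gammaN N pN x - \<gamma> (real x / real N)\<bar>) \<le> \<delta>"
    and limit: "limit_trajectory \<gamma> Tstar z"
  shows "is_martingale P (natural_filtration P Z) (comp_process N pN Z) \<and>
    (\<forall>p>1. \<forall>T>0.
      Lp_norm P p (\<lambda>\<omega>. SUP s\<in>{0..T}. \<bar>scaled_process N Z s \<omega> - z s\<bar>)
        \<le> (\<delta> * T + (1 + gammaN_bar N pN) / real N
             + p / (p - 1) * Lp_norm P p (\<lambda>\<omega>. comp_process N pN Z (nat \<lfloor>T * real N\<rfloor>) \<omega> / real N))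
           * exp (C\<^sub>L * T)) \<and>
    (\<forall>T>0.
      Lp_norm P 2 (\<lambda>\<omega>. SUP s\<in>{0..T}. \<bar>scaled_process N Z s \<omega> - z s\<bar>)
        \<le> (\<delta> * T + (1 + gammaN_bar N pN) / real N + 2 * sqrt (psiN_bar N pN * T / real N))
           * exp (C\<^sub>L * T))"
proof -
  interpret exploration_chain P N pN Z by (rule chain)
  have "\<bar>gammaN N pN k - \<gamma> (real k / real N)\<bar> \<le> \<delta>" if "k < N" for k
    using that approx by (intro order_trans[OF cSUP_upper approx]) auto
  note bound = Lp_error_bound[OF lipschitz this limit]
  show ?thesis
  proof (intro conjI allI impI martingale_comp bound)
    fix T :: real
    assume T: "0 < T"
    \<comment> \<open>The general bound at exponent two, where the constant
      \<open>p / (p - 1)\<close> equals \<open>2\<close>.\<close>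
    have "Lp_norm P 2 (\<lambda>\<omega>. SUP s\<in>{0..T}. \<bar>scaled_process N Z s \<omega> - z s\<bar>)
        \<le> (\<delta> * T + (1 + gammaN_bar N pN) / real N
             + 2 / (2 - 1) * Lp_norm P 2 (\<lambda>\<omega>. comp (nat \<lfloor>T * real N\<rfloor>) \<omega> / real N)) * exp (C\<^sub>L * T)"
      using T by (intro bound) auto
    also have "\<dots> \<le> (\<delta> * T + (1 + gammaN_bar N pN) / real N
        + 2 * sqrt (psiN_bar N pN * T / real N)) * exp (C\<^sub>L * T)"
      using L2_comp_le[OF T] by (intro mult_right_mono add_left_mono) auto
    finally show "Lp_norm P 2 (\<lambda>\<omega>. SUP s\<in>{0..T}. \<bar>scaled_process N Z s \<omega> - z s\<bar>)
        \<le> (\<delta> * T + (1 + gammaN_bar N pN) / real N + 2 * sqrt (psiN_bar N pN * T / real N))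
           * exp (C\<^sub>L * T)" .
  qed
qed

end
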